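(* For a discrete confocal coordinate system $\boldsymbol x=(x_1,\dots,x_N):(\tfrac12\mathbb Z)^N\supset\mathcal U\to\mathbb R^N$, there exist $N$ real numbers $a_k$, $1\le k\le N$, and $N$ sequences $u_i:\tfrac12\mathbb Z+\tfrac14\to\mathbb R$ such that the following equations are satisfied for any $\boldsymbol n\in\mathcal U$ and for any $\boldsymbol\sigma=(\sigma_1,\dots,\sigma_N)\in\{\pm1\}^N$: $$\sum_{k=1}^N\frac{x_k(\boldsymbol n)\,x_k(\boldsymbol n+\frac12\boldsymbol\sigma)}{a_k+u_i}=1,\qquad u_i=u_i(n_i+\tfrac14\sigma_i),\quad i=1,\dots,N.$$ Equivalently, $$x_k(\boldsymbol n)\,x_k(\boldsymbol n+\tfrac12\boldsymbol\sigma)=\frac{\prod_{j=1}^N(u_j+a_k)}{\prod_{j\ne k}(a_k-a_j)},\qquad u_j=u_j(n_j+\tfrac14\sigma_j),\quad k=1,\dots,N.$$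
   Context: $\boldsymbol e_i$ is the unit vector of the $i$-th coordinate direction. Equations are understood for those arguments for which all points involved lie in $\mathcal U$. Discrete coordinate system: a net $\boldsymbol x:(\tfrac12\mathbb Z)^N\supset\mathcal U\to\mathbb R^N$ such that at any $\boldsymbol n\in\mathcal U$ the $N$ discrete tangent vectors, arbitrarily chosen for each $j=1,\dots,N$ among $\Delta_j\boldsymbol x(\boldsymbol n)=\boldsymbol x(\boldsymbol n+\boldsymbol e_j)-\boldsymbol x(\boldsymbol n)$ and $\bar\Delta_j\boldsymbol x(\boldsymbol n)=\boldsymbol x(\boldsymbol n)-\boldsymbol x(\boldsymbol n-\boldsymbol e_j)$, are linearly independent. Orthogonal net: for each edge $[\boldsymbol n,\boldsymbol n+\boldsymbol e_i]$, all $2^{N-1}$ points $\boldsymbol x(\boldsymbol n+\frac12\boldsymbol\sigma)$ with $\boldsymbol\sigma\in\{\pm1\}^N$, $\sigma_i=1$, lie in a hyperplane orthogonal to the line through $\boldsymbol x(\boldsymbol n)$ and $\boldsymbol x(\boldsymbol n+\boldsymbol e_i)$. Discrete confocal coordinate system: a discrete coordinate system $\boldsymbol x:(\tfrac12\mathbb Z)^N\supset\mathcal U\to\mathbb R^N$ which (i) factorizes, in the sense that for any $\boldsymbol n\in\mathcal U$ one has $x_k(\boldsymbol n)=f_1^k(n_1)f_2^k(n_2)\cdots f_N^k(n_N)$, $k=1,\dots,N$, with $f_i^k(n_i)\ne0$ and $f_i^k(n_i)-f_i^k(n_i-1)\neq0$; and (ii) is an orthogonal net.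
   Formalization: Proved for U a connected union of full cells (3^N half-lattice points each) and, if N > 1, for nets having in every direction an edge not on a line through the origin; without these the claim fails, e.g. for discrete polar coordinates or disconnected U. *)

theory Defs
  imports "HOL-Analysis.Analysis"
begin

definition half_lattice :: "(real ^ 'n) set" where
  "half_lattice = {n. \<forall>i. 2 * n $ i \<in> \<int>}"

definition sign_vectors :: "(real ^ 'n) set" where
  "sign_vectors = {\<sigma>. \<forall>i. \<sigma> $ i = 1 \<or> \<sigma> $ i = -1}"

text \<open>
  The discrete counterpart of a domain (a connected set with full-dimensional local pieces): a
  union of cells, each consisting of the \<open>3^N\<close> half-lattice points around its centre, where any
  two centres are joined by a chain of centres with steps of length 1/2 along the axes. Boxes
  with at least three half-lattice points in each direction and the whole half-lattice are
  examples. For arbitrary subsets of the half-lattice the confocality equations can fail, for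
  instance because two components carry unrelated confocal systems.
\<close>

definition lattice_cell :: "real ^ 'n \<Rightarrow> (real ^ 'n) set" where
  "lattice_cell c = {n \<in> half_lattice. \<forall>i. \<bar>n $ i - c $ i\<bar> \<le> 1 / 2}"

definition lattice_neighbours :: "(real ^ 'n) set \<Rightarrow> ((real ^ 'n) \<times> (real ^ 'n)) set" where
  "lattice_neighbours C =
     {(c, d). c \<in> C \<and> d \<in> C \<and> (\<exists>i. d = c + axis i (1 / 2) \<or> c = d + axis i (1 / 2))}"

definition lattice_domain :: "(real ^ 'n) set \<Rightarrow> bool" where
  "lattice_domain U \<longleftrightarrow>
     (\<exists>C. C \<noteq> {} \<and> C \<subseteq> half_lattice \<and> C \<times> C \<subseteq> (lattice_neighbours C)\<^sup>* \<and>
          U = (\<Union>c\<in>C. lattice_cell c))"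

text \<open>
  A net is a total function of which only the values on \<open>U\<close> matter. A family \<open>t\<close> picks for each
  direction \<open>j\<close> the forward or the backward difference, subject to its end points lying in \<open>U\<close>.
\<close>

definition discrete_coordinate_system :: "(real ^ 'n) set \<Rightarrow> (real ^ 'n \<Rightarrow> real ^ 'n) \<Rightarrow> bool" where
  "discrete_coordinate_system U x \<longleftrightarrow>
     U \<subseteq> half_lattice \<and>
     (\<forall>n\<in>U. \<forall>t.
        (\<forall>j. n + axis j 1 \<in> U \<and> t j = x (n + axis j 1) - x n \<or>
             n - axis j 1 \<in> U \<and> t j = x n - x (n - axis j 1)) \<longrightarrow>
        inj t \<and> independent (range t))"

definition orthogonal_net :: "(real ^ 'n) set \<Rightarrow> (real ^ 'n \<Rightarrow> real ^ 'n) \<Rightarrow> bool" where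
  "orthogonal_net U x \<longleftrightarrow>
     (\<forall>n i. n \<in> U \<and> n + axis i 1 \<in> U \<and>
        (\<forall>\<sigma>\<in>sign_vectors. \<sigma> $ i = 1 \<longrightarrow> n + (1 / 2) *\<^sub>R \<sigma> \<in> U) \<longrightarrow>
        (\<exists>b. \<forall>\<sigma>\<in>sign_vectors. \<sigma> $ i = 1 \<longrightarrow>
           x (n + (1 / 2) *\<^sub>R \<sigma>) \<in> {y. (x (n + axis i 1) - x n) \<bullet> y = b}))"

definition factorizes :: "(real ^ 'n) set \<Rightarrow> (real ^ 'n \<Rightarrow> real ^ 'n) \<Rightarrow> bool" where
  "factorizes U x \<longleftrightarrow>
     (\<exists>f :: 'n \<Rightarrow> 'n \<Rightarrow> real \<Rightarrow> real. \<forall>n\<in>U. \<forall>k.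
        x n $ k = (\<Prod>i\<in>UNIV. f i k (n $ i)) \<and>
        (\<forall>i. f i k (n $ i) \<noteq> 0 \<and> f i k (n $ i) - f i k (n $ i - 1) \<noteq> 0))"

definition discrete_confocal_coordinate_system ::
  "(real ^ 'n) set \<Rightarrow> (real ^ 'n \<Rightarrow> real ^ 'n) \<Rightarrow> bool" where
  "discrete_confocal_coordinate_system U x \<longleftrightarrow>
     discrete_coordinate_system U x \<and> factorizes U x \<and> orthogonal_net U x"

text \<open>
  For \<open>N > 1\<close>: in no direction do all edges of the net lie on lines through the origin. This
  rules out conical systems such as discrete polar coordinates
  \<open>r(n\<^sub>1) (cos (n\<^sub>2 \<delta>), sin (n\<^sub>2 \<delta>))\<close>, which are orthogonal and factorize but
  do not satisfy the equations below. It is necessary for those equations to be solvable: on an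
  edge in direction \<open>i\<close> they give
  \<open>x\<^sub>k(n + e\<^sub>i) / x\<^sub>k(n) = (u\<^sub>i(n\<^sub>i + 3/4) + a\<^sub>k) / (u\<^sub>i(n\<^sub>i + 1/4) + a\<^sub>k)\<close>,
  which depends on \<open>k\<close>.
\<close>

definition non_conical :: "(real ^ 'n) set \<Rightarrow> (real ^ 'n \<Rightarrow> real ^ 'n) \<Rightarrow> bool" where
  "non_conical U x \<longleftrightarrow>
     (CARD('n) > 1 \<longrightarrow>
      (\<forall>i. \<exists>n. n \<in> U \<and> n + axis i 1 \<in> U \<and> x (n + axis i 1) \<notin> span {x n}))"

text \<open>
  The sequence \<open>u i\<close> is only used at arguments in \<open>\<int>/2 + 1/4\<close>. Denominators are required to be
  nonzero explicitly, since division by zero is total.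
\<close>

definition polarity_equations ::
  "(real ^ 'n) set \<Rightarrow> (real ^ 'n \<Rightarrow> real ^ 'n) \<Rightarrow> ('n \<Rightarrow> real) \<Rightarrow> ('n \<Rightarrow> real \<Rightarrow> real) \<Rightarrow> bool" where
  "polarity_equations U x a u \<longleftrightarrow>
     (\<forall>n\<in>U. \<forall>\<sigma>\<in>sign_vectors. n + (1 / 2) *\<^sub>R \<sigma> \<in> U \<longrightarrow>
        (\<forall>i. (\<forall>k. a k + u i (n $ i + \<sigma> $ i / 4) \<noteq> 0) \<and>
             (\<Sum>k\<in>UNIV. x n $ k * x (n + (1 / 2) *\<^sub>R \<sigma>) $ k /
                        (a k + u i (n $ i + \<sigma> $ i / 4))) = 1))"

definition product_equations ::
  "(real ^ 'n) set \<Rightarrow> (real ^ 'n \<Rightarrow> real ^ 'n) \<Rightarrow> ('n \<Rightarrow> real) \<Rightarrow> ('n \<Rightarrow> real \<Rightarrow> real) \<Rightarrow> bool" where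
  "product_equations U x a u \<longleftrightarrow>
     (\<forall>n\<in>U. \<forall>\<sigma>\<in>sign_vectors. n + (1 / 2) *\<^sub>R \<sigma> \<in> U \<longrightarrow>
        (\<forall>k. (\<forall>j. j \<noteq> k \<longrightarrow> a k - a j \<noteq> 0) \<and>
             x n $ k * x (n + (1 / 2) *\<^sub>R \<sigma>) $ k =
               (\<Prod>j\<in>UNIV. u j (n $ j + \<sigma> $ j / 4) + a k) / (\<Prod>j\<in>UNIV - {k}. a k - a j)))"

end

theory Submission
  imports Defs "HOL-Computational_Algebra.Polynomial"
begin

text \<open>
  The theorem becomes transparent on the dual lattice, whose points \<open>n + \<sigma>/4\<close> are the midpoints
  of the pairs \<open>n\<close>, \<open>n + \<sigma>/2\<close>. Because the net factorizes, \<open>x\<^sub>k(n) x\<^sub>k(n + \<sigma>/2)\<close> is a product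
  \<open>g\<^sub>1\<^sup>k(m\<^sub>1) \<cdots> g\<^sub>N\<^sup>k(m\<^sub>N)\<close> of functions of one dual coordinate each, with
  \<open>g\<^sub>i\<^sup>k(m) = f\<^sub>i\<^sup>k(m - 1/4) f\<^sub>i\<^sup>k(m + 1/4)\<close>; and orthogonality says that the mixed second differences of
  \<open>\<Sum>\<^sub>k g\<^sub>1\<^sup>k(m\<^sub>1) \<cdots> g\<^sub>N\<^sup>k(m\<^sub>N)\<close> vanish on every cell of the dual lattice.

  Fix a cell, let \<open>W\<^sub>k\<close> be the product of the \<open>g\<^sub>l\<^sup>k\<close> at its lowest corner, and let
  \<open>q\<^sub>i\<^sup>k\<close> be the relative increment of \<open>g\<^sub>i\<^sup>k\<close> across the cell. The vectors \<open>q\<^sub>1, \<dots>, q\<^sub>N\<close> are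
  linearly independent, since up to the factors \<open>x\<^sub>k\<close> they are the tangent vectors, and they are
  orthogonal for the nondegenerate form \<open>\<Sum>\<^sub>k W\<^sub>k v\<^sub>k w\<^sub>k\<close>. Three consequences carry the proof.

  First, in two adjacent cells that differ by a step in direction \<open>i\<close>, both increments of \<open>g\<^sub>i\<close>
  give vectors orthogonal to the same \<open>N - 1\<close> vectors \<open>q\<^sub>j\<close>. Hence all increments of the curve
  \<open>g\<^sub>i = (g\<^sub>i\<^sup>1, \<dots>, g\<^sub>i\<^sup>N)\<close> are parallel (\<open>adjacent_increments_parallel\<close>), and the curve stays on a
  line (\<open>on_line\<close>).

  Secondly, third differences vanish too, so \<open>q\<^sub>i q\<^sub>j\<close> is orthogonal to every other \<open>q\<^sub>l\<close> and lies
  in the span of \<open>q\<^sub>i\<close> and \<open>q\<^sub>j\<close> (\<open>frame_products\<close>). Dividing by \<open>q\<^sub>i q\<^sub>j\<close> gives an affine relation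
  between \<open>1/q\<^sub>i\<close> and \<open>1/q\<^sub>j\<close>. For \<open>N > 1\<close> no direction is conical, so no \<open>1/q\<^sub>i\<close> is constant in \<open>k\<close>, and all
  of them are affine functions of a single vector \<open>a\<close>; thus
  \<open>g\<^sub>i\<^sup>k(m) = \<kappa>\<^sub>i\<^sup>k (a\<^sub>k + u\<^sub>i(m))\<close> (\<open>linear_in_common_parameter\<close>).

  Thirdly, orthogonality of the \<open>q\<^sub>i\<close> determines \<open>\<Prod>\<^sub>i \<kappa>\<^sub>i\<^sup>k\<close> up to a common factor \<open>\<mu>\<close>, and Lagrange
  interpolation identifies it as \<open>\<mu> / \<Prod>\<^sub>j\<^sub>\<noteq>\<^sub>k (a\<^sub>k - a\<^sub>j)\<close> (\<open>linear_imp_product_formula\<close>). Rescaling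
  \<open>a\<close> and \<open>u\<close> by \<open>\<mu>\<close> gives the product equations, and the polarity equations follow by
  Lagrange interpolation again. Conversely, if the polarity equations hold for some \<open>a\<close> and \<open>u\<close>, then
  \<open>1/(a + u\<^sub>i)\<close> is orthogonal to all \<open>q\<^sub>j\<close> with \<open>j \<noteq> i\<close>, hence a multiple of \<open>q\<^sub>i\<close>; this forces
  \<open>g\<^sub>i\<close> into the linear form above (\<open>polarity_imp_linear\<close>), and the normalization to \<open>1\<close> forces \<open>\<mu> = 1\<close>.
\<close>

section \<open>Lagrange interpolation and the product equations\<close>

text \<open>
  The sum is the coefficient of \<open>x\<^sup>N\<^sup>-\<^sup>1\<close> in the Lagrange interpolation polynomial of
  \<open>\<Prod>\<^sub>l (v\<^sub>l + x)\<close> at the \<open>N\<close> nodes \<open>a\<^sub>k\<close>. That polynomial has degree less than \<open>N\<close>, so it is its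
  own interpolation polynomial.
\<close>
lemma lagrange_sum_of_linear_factors:
  fixes a v :: "'n :: finite \<Rightarrow> real" and R :: "'n set"
  assumes "inj a" and R: "card R < CARD('n)"
  shows "(\<Sum>k\<in>UNIV. (\<Prod>l\<in>R. v l + a k) / (\<Prod>j\<in>UNIV-{k}. a k - a j)) =
    (if card R + 1 = CARD('n) then 1 else 0)"
proof -
  define N where "N = CARD('n) - 1"
  define P where "P = (\<Prod>l\<in>R. [:v l, 1:])"
  define L where "L k = (\<Prod>j\<in>UNIV-{k}. [:- a j, 1:])" for k
  define S where "S = (\<Sum>k\<in>UNIV. smult (poly P (a k) / poly (L k) (a k)) (L k))"
  have ne: "a k \<noteq> a j" if "k \<noteq> j" for k j
    using \<open>inj a\<close> that by (auto dest: injD)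
  have [simp]: "degree P = card R"
    unfolding P_def by (simp add: degree_prod_eq_sum_degree)
  have "lead_coeff P = 1"
    unfolding P_def lead_coeff_prod by simp
  have [simp]: "degree (L k) = N" for k
    unfolding L_def by (simp add: degree_prod_eq_sum_degree N_def card_Diff_singleton)
  have lead: "coeff (L k) N = 1" for k
  proof -
    have "lead_coeff (L k) = 1" unfolding L_def lead_coeff_prod by simp
    then show ?thesis by simp
  qed
  have Lk: "poly (L k) x = (\<Prod>j\<in>UNIV-{k}. x - a j)" for k x
    unfolding L_def by (simp add: poly_prod)
  have L0: "poly (L k) (a k) \<noteq> 0" for k
    using ne by (auto simp: Lk)
  have Lj: "poly (L k) (a j) = 0" if "k \<noteq> j" for k j
    using that by (auto simp: Lk)
  have "P = S"
  proof (rule poly_eqI_degree[where A = "range a"])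
    fix x assume "x \<in> range a"
    then obtain j where x: "x = a j" by blast
    have "poly S x = (\<Sum>k\<in>UNIV. if k = j then poly P (a j) else 0)"
      unfolding S_def poly_sum poly_smult x
      by (rule sum.cong) (auto simp: Lj L0)
    then show "poly P x = poly S x" by (simp add: x)
  next
    have c: "card (range a) = CARD('n)" using \<open>inj a\<close> by (rule card_image)
    show "degree P < card (range a)" using R c by simp
    have "degree S \<le> N" unfolding S_def
      by (rule degree_sum_le) (auto intro: order_trans[OF degree_smult_le])
    then show "degree S < card (range a)" unfolding c N_def
      by (simp add: less_eq_Suc_le) (metis One_nat_def Suc_diff_Suc Suc_le_mono diff_zero zero_less_card_finite)
  qed
  then have "coeff P N = coeff S N" by simp
  also have "\<dots> = (\<Sum>k\<in>UNIV. poly P (a k) / poly (L k) (a k))"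
    unfolding S_def by (simp add: coeff_sum lead)
  also have "\<dots> = (\<Sum>k\<in>UNIV. (\<Prod>l\<in>R. v l + a k) / (\<Prod>j\<in>UNIV-{k}. a k - a j))"
    unfolding Lk by (simp add: P_def poly_prod)
  finally have "(\<Sum>k\<in>UNIV. (\<Prod>l\<in>R. v l + a k) / (\<Prod>j\<in>UNIV-{k}. a k - a j)) = coeff P N" ..
  moreover have "coeff P N = (if card R + 1 = CARD('n) then 1 else 0)"
  proof (cases "card R + 1 = CARD('n)")
    case True
    then have "N = degree P" by (simp add: N_def)
    with True \<open>lead_coeff P = 1\<close> show ?thesis by simp
  next
    case False
    with R have "degree P < N" by (simp add: N_def)
    with False show ?thesis by (simp add: coeff_eq_0)
  qed
  ultimately show ?thesis by simp
qed

lemma polarity_of_product_formula: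
  fixes a w :: "'n :: finite \<Rightarrow> real"
  assumes "inj a" and w: "\<And>k. a k + w i \<noteq> 0"
  shows "(\<Sum>k\<in>UNIV. (\<Prod>j\<in>UNIV. w j + a k) / (\<Prod>j\<in>UNIV-{k}. a k - a j) / (a k + w i)) = 1"
proof -
  have "(\<Prod>j\<in>UNIV. w j + a k) / (\<Prod>j\<in>UNIV-{k}. a k - a j) / (a k + w i) =
      (\<Prod>j\<in>UNIV-{i}. w j + a k) / (\<Prod>j\<in>UNIV-{k}. a k - a j)" for k
    using w[of k] by (subst prod.remove[of UNIV i]) (simp_all add: add.commute)
  moreover have "card (UNIV - {i}) + 1 = CARD('n)" by (simp add: card_Diff_singleton)
  ultimately show ?thesis
    using lagrange_sum_of_linear_factors[OF assms(1), of "UNIV - {i}" w] by simp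
qed

lemma product_imp_polarity:
  assumes nz: "\<And>n k. n \<in> U \<Longrightarrow> x n $ k \<noteq> 0"
    and prod: "product_equations U x a u"
  shows "polarity_equations U x a u"
  unfolding polarity_equations_def
proof (intro ballI impI allI)
  fix n \<sigma> i assume n: "n \<in> U" and \<sigma>: "\<sigma> \<in> sign_vectors" "n + (1 / 2) *\<^sub>R \<sigma> \<in> U"
  define w where "w j = u j (n $ j + \<sigma> $ j / 4)" for j
  from prod n \<sigma> have ne: "j \<noteq> k \<Longrightarrow> a k - a j \<noteq> 0"
    and eq: "x n $ k * x (n + (1 / 2) *\<^sub>R \<sigma>) $ k =
      (\<Prod>j\<in>UNIV. w j + a k) / (\<Prod>j\<in>UNIV-{k}. a k - a j)" for j k
    unfolding product_equations_def w_def by blast+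
  have "inj a" using ne by (metis injI eq_iff_diff_eq_0)
  have "(\<Prod>j\<in>UNIV. w j + a k) \<noteq> 0" for k
    using eq[of k] nz[OF n, of k] nz[OF \<sigma>(2), of k] by (metis div_0 mult_eq_0_iff)
  then have w: "a k + w j \<noteq> 0" for k j by (metis UNIV_I add.commute finite prod_zero)
  have "(\<Sum>k\<in>UNIV. x n $ k * x (n + (1 / 2) *\<^sub>R \<sigma>) $ k / (a k + w i)) = 1"
    unfolding eq by (rule polarity_of_product_formula) fact+
  with w show "(\<forall>k. a k + u i (n $ i + \<sigma> $ i / 4) \<noteq> 0) \<and>
      (\<Sum>k\<in>UNIV. x n $ k * x (n + (1 / 2) *\<^sub>R \<sigma>) $ k / (a k + u i (n $ i + \<sigma> $ i / 4))) = 1"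
    unfolding w_def by blast
qed

section \<open>Orthogonal frames of a diagonal bilinear form\<close>
lemma independent_family_spans:
  fixes q :: "'n :: finite \<Rightarrow> 'n \<Rightarrow> real"
  assumes indep: "\<And>s. (\<And>k. (\<Sum>j\<in>UNIV. s j * q j k) = 0) \<Longrightarrow> \<forall>j. s j = 0"
  shows "\<exists>s. \<forall>k. v k = (\<Sum>j\<in>UNIV. s j * q j k)"
proof -
  define T :: "real ^ 'n \<Rightarrow> real ^ 'n" where "T s = (\<chi> k. \<Sum>j\<in>UNIV. s $ j * q j k)" for s
  have "linear T"
    by (rule linearI)
      (simp_all add: T_def vec_eq_iff algebra_simps sum.distrib sum_distrib_left)
  moreover have "inj T"
    unfolding linear_injective_0[OF \<open>linear T\<close>]
  proof (intro allI impI)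
    fix s assume "T s = 0"
    then have "\<forall>j. s $ j = 0" by (intro indep) (simp add: T_def vec_eq_iff)
    then show "s = 0" by (simp add: vec_eq_iff)
  qed
  ultimately have "surj T" by (rule linear_inj_imp_surj)
  then obtain s where "(\<chi> k. v k) = T s" by blast
  then have "\<forall>k. v k = (\<Sum>j\<in>UNIV. s $ j * q j k)" by (simp add: T_def vec_eq_iff)
  then show ?thesis by (intro exI)
qed

text \<open>
  The form \<open>\<Sum>\<^sub>k W\<^sub>k v\<^sub>k w\<^sub>k\<close> may be indefinite, so a basis vector could a priori be isotropic. It
  is not: an isotropic \<open>q\<^sub>j\<close> would be orthogonal to the whole space, and the form is nondegenerate.
  So the coefficient of \<open>v\<close> at \<open>q\<^sub>j\<close> vanishes as soon as \<open>v\<close> is orthogonal to \<open>q\<^sub>j\<close>.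
\<close>
lemma orthogonal_frame_expansion:
  fixes q :: "'n :: finite \<Rightarrow> 'n \<Rightarrow> real"
  assumes indep: "\<And>s. (\<And>k. (\<Sum>j\<in>UNIV. s j * q j k) = 0) \<Longrightarrow> \<forall>j. s j = 0"
    and W: "\<And>k. W k \<noteq> 0"
    and orth: "\<And>i j. i \<noteq> j \<Longrightarrow> (\<Sum>k\<in>UNIV. W k * q i k * q j k) = 0"
    and v: "\<And>j. j \<notin> S \<Longrightarrow> (\<Sum>k\<in>UNIV. W k * v k * q j k) = 0"
  shows "\<exists>s. \<forall>k. v k = (\<Sum>j\<in>S. s j * q j k)"
proof -
  have expand: "\<exists>s. \<forall>k. y k = (\<Sum>j\<in>UNIV. s j * q j k)" for y
    using independent_family_spans[OF indep] .
  have form: "(\<Sum>k\<in>UNIV. W k * y k * q j k) = s j * (\<Sum>k\<in>UNIV. W k * q j k * q j k)"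
    if y: "\<forall>k. y k = (\<Sum>j\<in>UNIV. s j * q j k)" for y s j
  proof -
    have "(\<Sum>k\<in>UNIV. W k * y k * q j k) = (\<Sum>k\<in>UNIV. \<Sum>i\<in>UNIV. s i * (W k * q i k * q j k))"
      unfolding y[rule_format] by (simp add: sum_distrib_left sum_distrib_right mult_ac)
    also have "\<dots> = (\<Sum>i\<in>UNIV. s i * (\<Sum>k\<in>UNIV. W k * q i k * q j k))"
      by (subst sum.swap) (simp add: sum_distrib_left)
    also have "\<dots> = (\<Sum>i\<in>UNIV. if i = j then s j * (\<Sum>k\<in>UNIV. W k * q j k * q j k) else 0)"
      by (rule sum.cong) (auto simp: orth)
    finally show ?thesis by simp
  qed
  have norm: "(\<Sum>k\<in>UNIV. W k * q j k * q j k) \<noteq> 0" for j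
  proof
    assume 0: "(\<Sum>k\<in>UNIV. W k * q j k * q j k) = 0"
    have "q j k = 0" for k
    proof -
      \<comment> \<open>Testing against the unit vectors shows that an isotropic frame vector would vanish.\<close>
      obtain s where "\<forall>i. (if i = k then 1 else 0 :: real) = (\<Sum>j\<in>UNIV. s j * q j i)"
        using expand[of "\<lambda>i. if i = k then 1 else 0"] by blast
      from form[OF this, of j] 0 have "(\<Sum>i\<in>UNIV. W i * (if i = k then 1 else 0) * q j i) = 0"
        by simp
      also have "(\<Sum>i\<in>UNIV. W i * (if i = k then 1 else 0) * q j i) =
          (\<Sum>i\<in>UNIV. if i = k then W k * q j k else 0)"
        by (rule sum.cong) auto
      finally show ?thesis using W by simp
    qed
    then have "\<forall>i. (if i = j then 1 else 0 :: real) = 0"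
      by (intro indep) (auto intro!: sum.neutral)
    from spec[OF this, of j] show False by simp
  qed
  obtain s where s: "\<forall>k. v k = (\<Sum>j\<in>UNIV. s j * q j k)" using expand[of v] by blast
  have "s j = 0" if "j \<notin> S" for j
    using form[OF s, of j] norm[of j] v[OF that] by simp
  then have "(\<Sum>j\<in>UNIV. s j * q j k) = (\<Sum>j\<in>S. s j * q j k)" for k
    by (intro sum.mono_neutral_right) auto
  with s show ?thesis by auto
qed

lemma prod_remove_two: "i \<noteq> j \<Longrightarrow> (\<Prod>l\<in>UNIV. h l) = h i * h j * (\<Prod>l\<in>UNIV-{i, j}. h l)"
  for h :: "'n :: finite \<Rightarrow> real"
  by (subst prod.remove[of UNIV i], simp, simp, subst prod.remove[of "UNIV-{i}" j])
    (auto simp: Diff_insert2[symmetric] mult.assoc)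

section \<open>Orthogonal systems on the dual lattice\<close>

text \<open>
  The functions \<open>g i k\<close> live on the dual coordinates \<open>t \<plusminus> 1/4\<close> of the centres. The assumption
  \<open>orthogonal\<close> states that the mixed second differences of \<open>\<Sum>\<^sub>k \<Prod>\<^sub>l g l k (m l)\<close> vanish on each dual
  cell; \<open>independent\<close> is the linear independence of the tangent vectors at the lowest corner of a
  cell, after division of their components by the coordinates of that corner.
\<close>
locale dual_orthogonal_system =
  fixes C :: "(real ^ 'n) set" and g :: "'n \<Rightarrow> 'n \<Rightarrow> real \<Rightarrow> real"
  assumes centres_nonempty: "C \<noteq> {}"
    and centres_half_lattice: "C \<subseteq> half_lattice"
    and centres_connected: "C \<times> C \<subseteq> (lattice_neighbours C)\<^sup>*"
    and lower_nonzero: "c \<in> C \<Longrightarrow> g i k (c $ i - 1 / 4) \<noteq> 0"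
    and upper_nonzero: "c \<in> C \<Longrightarrow> g i k (c $ i + 1 / 4) \<noteq> 0"
    and increment_nonzero: "c \<in> C \<Longrightarrow> g i k (c $ i + 1 / 4) - g i k (c $ i - 1 / 4) \<noteq> 0"
    and orthogonal: "c \<in> C \<Longrightarrow> i \<noteq> j \<Longrightarrow> \<forall>l. \<sigma> l = 1 \<or> \<sigma> l = -1 \<Longrightarrow>
      (\<Sum>k\<in>UNIV. (g i k (c $ i + 1 / 4) - g i k (c $ i - 1 / 4)) *
        (g j k (c $ j + 1 / 4) - g j k (c $ j - 1 / 4)) *
        (\<Prod>l\<in>UNIV-{i, j}. g l k (c $ l + \<sigma> l / 4))) = 0"
    and independent: "c \<in> C \<Longrightarrow>
      (\<And>k. (\<Sum>j\<in>UNIV. s j * ((g j k (c $ j + 1 / 4) - g j k (c $ j - 1 / 4)) /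
        g j k (c $ j - 1 / 4))) = 0) \<Longrightarrow> \<forall>j. s j = 0"
begin

text \<open>
  A property of one coordinate only has to be transported along the axis in question, because all
  other steps of a chain of centres leave that coordinate alone.
\<close>
lemma coordinate_induct:
  assumes c0: "c0 \<in> C" and start: "Q (c0 $ i)"
    and step: "\<And>c. c \<in> C \<Longrightarrow> c + axis i (1 / 2) \<in> C \<Longrightarrow> Q (c $ i) \<longleftrightarrow> Q (c $ i + 1 / 2)"
    and c: "c \<in> C"
  shows "Q (c $ i)"
proof -
  have "(c0, c) \<in> (lattice_neighbours C)\<^sup>*" using centres_connected c0 c by blast
  then show ?thesis
  proof (induction rule: rtrancl_induct)
    case base
    show ?case using start .
  next
    case (step d e)
    then obtain j where j: "d \<in> C" "e \<in> C" "e = d + axis j (1 / 2) \<or> d = e + axis j (1 / 2)"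
      by (auto simp: lattice_neighbours_def)
    show ?case
    proof (cases "j = i")
      case True
      with j show ?thesis using step.IH assms(3)[of d] assms(3)[of e]
        by (auto simp: axis_def)
    next
      case False
      with j have "e $ i = d $ i" by (auto simp: axis_def)
      with step.IH show ?thesis by simp
    qed
  qed
qed

text \<open>
  Connectedness makes each projection of the set of centres an interval of half-integers.
\<close>
lemma coordinate_between:
  assumes "c \<in> C" "d \<in> C" and t: "2 * t \<in> \<int>" and "c $ i \<le> t" "t \<le> d $ i"
  shows "\<exists>e\<in>C. e $ i = t"
proof (rule ccontr)
  assume none: "\<not> (\<exists>e\<in>C. e $ i = t)"
  have "d $ i < t"
  proof (rule coordinate_induct[where Q = "\<lambda>s. s < t"])
    show "c \<in> C" "d \<in> C" by fact+
    show "c $ i < t" using none assms(1,4) by force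
    fix e assume e: "e \<in> C" "e + axis i (1 / 2) \<in> C"
    have "e $ i + 1 / 2 \<noteq> t" using none e(2) by (auto simp: axis_def dest!: bspec)
    have "2 * (e $ i) \<in> \<int>"
      using e(1) centres_half_lattice by (auto simp: half_lattice_def)
    with t obtain p q :: int where pq: "2 * (e $ i) = real_of_int p" "2 * t = real_of_int q"
      by (auto elim!: Ints_cases)
    with \<open>e $ i + 1 / 2 \<noteq> t\<close> have "real_of_int (p + 1) \<noteq> real_of_int q" by simp
    then have "p + 1 \<noteq> q" by (simp only: of_int_eq_iff simp_thms)
    then have "p < q \<longleftrightarrow> p + 1 < q" by arith
    moreover have "e $ i < t \<longleftrightarrow> real_of_int p < real_of_int q" using pq by linarith
    moreover have "e $ i + 1 / 2 < t \<longleftrightarrow> real_of_int (p + 1) < real_of_int q" using pq by simp linarith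
    ultimately show "e $ i < t \<longleftrightarrow> e $ i + 1 / 2 < t" by (simp only: of_int_less_iff)
  qed
  with \<open>t \<le> d $ i\<close> show False by simp
qed

definition dual_coordinates :: "'n \<Rightarrow> real set" where
  "dual_coordinates i = (\<lambda>c. c $ i - 1 / 4) ` C \<union> (\<lambda>c. c $ i + 1 / 4) ` C"

definition increment :: "'n \<Rightarrow> 'n \<Rightarrow> real \<Rightarrow> real" where
  "increment i k t = g i k (t + 1 / 4) - g i k (t - 1 / 4)"

definition weight :: "real ^ 'n \<Rightarrow> 'n \<Rightarrow> real" where
  "weight c k = (\<Prod>l\<in>UNIV. g l k (c $ l - 1 / 4))"

text \<open>
  For a net, these are the tangent vectors of a cell at its lowest corner, divided componentwise by
  the position vector of that corner.
\<close>
definition frame :: "real ^ 'n \<Rightarrow> 'n \<Rightarrow> 'n \<Rightarrow> real" where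
  "frame c j k = increment j k (c $ j) / g j k (c $ j - 1 / 4)"

lemma weight_nonzero: "c \<in> C \<Longrightarrow> weight c k \<noteq> 0"
  by (simp add: weight_def lower_nonzero)

lemma frame_nonzero: "c \<in> C \<Longrightarrow> frame c j k \<noteq> 0"
  using increment_nonzero lower_nonzero by (simp add: frame_def increment_def)

lemma increment_eq_frame: "c \<in> C \<Longrightarrow> increment j k (c $ j) = frame c j k * g j k (c $ j - 1 / 4)"
  by (simp add: frame_def lower_nonzero)

lemma frame_independent:
  "c \<in> C \<Longrightarrow> (\<And>k. (\<Sum>j\<in>UNIV. s j * frame c j k) = 0) \<Longrightarrow> \<forall>j. s j = 0"
  using independent unfolding frame_def increment_def by blast

lemma lower_corner_orthogonal:
  assumes "c \<in> C" "i \<noteq> j"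
  shows "(\<Sum>k\<in>UNIV. increment i k (c $ i) * increment j k (c $ j) *
    (\<Prod>l\<in>UNIV-{i, j}. g l k (c $ l - 1 / 4))) = 0"
  using orthogonal[OF assms, of "\<lambda>_. -1"] by (simp add: increment_def)

lemma frame_orthogonal:
  assumes "c \<in> C" "i \<noteq> j"
  shows "(\<Sum>k\<in>UNIV. weight c k * frame c i k * frame c j k) = 0"
proof -
  have "weight c k * frame c i k * frame c j k = increment i k (c $ i) * increment j k (c $ j) *
      (\<Prod>l\<in>UNIV-{i, j}. g l k (c $ l - 1 / 4))" for k
    unfolding weight_def prod_remove_two[OF assms(2)] increment_eq_frame[OF assms(1)] by (simp add: mult_ac)
  with lower_corner_orthogonal[OF assms] show ?thesis by simp
qed

text \<open>
  The second difference in directions \<open>i\<close> and \<open>j\<close> vanishes at both ends of an edge in direction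
  \<open>l\<close>, hence so does the third difference.
\<close>
lemma frame_triple_orthogonal:
  assumes c: "c \<in> C" and ij: "i \<noteq> j" and l: "l \<noteq> i" "l \<noteq> j"
  shows "(\<Sum>k\<in>UNIV. weight c k * (frame c i k * frame c j k) * frame c l k) = 0"
proof -
  define F where "F s = (\<Sum>k\<in>UNIV. increment i k (c $ i) * increment j k (c $ j) *
    (g l k (c $ l + s / 4) * (\<Prod>m\<in>UNIV-{i, j, l}. g m k (c $ m - 1 / 4))))" for s
  have F: "F s = 0" if "s = 1 \<or> s = -1" for s
  proof -
    have "(\<Prod>m\<in>UNIV-{i, j}. g m k (c $ m + (if m = l then s else -1) / 4)) =
        g l k (c $ l + s / 4) * (\<Prod>m\<in>UNIV-{i, j, l}. g m k (c $ m - 1 / 4))" for k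
      using l by (subst prod.remove[of _ l]) (auto intro!: prod.cong)
    with orthogonal[OF c ij, of "\<lambda>m. if m = l then s else -1"] that show ?thesis
      by (simp add: F_def increment_def)
  qed
  have "weight c k * (frame c i k * frame c j k) * frame c l k =
      increment i k (c $ i) * increment j k (c $ j) *
      (increment l k (c $ l) * (\<Prod>m\<in>UNIV-{i, j, l}. g m k (c $ m - 1 / 4)))" for k
  proof -
    have "(\<Prod>m\<in>UNIV-{i, j}. g m k (c $ m - 1 / 4)) =
        g l k (c $ l - 1 / 4) * (\<Prod>m\<in>UNIV-{i, j, l}. g m k (c $ m - 1 / 4))"
      using l by (subst prod.remove[of _ l]) (auto intro!: prod.cong)
    then show ?thesis
      unfolding weight_def prod_remove_two[OF ij] increment_eq_frame[OF c] by (simp add: mult_ac)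
  qed
  then have "(\<Sum>k\<in>UNIV. weight c k * (frame c i k * frame c j k) * frame c l k) = F 1 - F (-1)"
    unfolding F_def sum_subtractf[symmetric] right_diff_distrib[symmetric]
      left_diff_distrib[symmetric] increment_def[of l] by simp
  then show ?thesis using F by simp
qed

lemma frame_expansion:
  assumes c: "c \<in> C" and v: "\<And>j. j \<notin> S \<Longrightarrow> (\<Sum>k\<in>UNIV. weight c k * v k * frame c j k) = 0"
  shows "\<exists>s. \<forall>k. v k = (\<Sum>j\<in>S. s j * frame c j k)"
  using frame_independent[OF c] weight_nonzero[OF c] frame_orthogonal[OF c] v
  by (rule orthogonal_frame_expansion)

lemma orthogonal_to_others_imp_multiple:
  assumes "c \<in> C" and "\<And>j. j \<noteq> i \<Longrightarrow> (\<Sum>k\<in>UNIV. weight c k * v k * frame c j k) = 0"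
  shows "\<exists>s. \<forall>k. v k = s * frame c i k"
proof -
  have "\<exists>s. \<forall>k. v k = (\<Sum>j\<in>{i}. s j * frame c j k)"
    using assms by (intro frame_expansion) auto
  then show ?thesis by auto
qed

text \<open>
  By the vanishing of third differences, the componentwise product is orthogonal to all frame
  vectors other than its two factors.
\<close>
lemma frame_products:
  assumes c: "c \<in> C" and "i \<noteq> j"
  shows "\<exists>\<alpha> \<beta>. \<forall>k. frame c i k * frame c j k = \<alpha> * frame c i k + \<beta> * frame c j k"
proof -
  have "\<exists>s. \<forall>k. frame c i k * frame c j k = (\<Sum>l\<in>{i, j}. s l * frame c l k)"
    using frame_triple_orthogonal[OF assms] by (intro frame_expansion[OF c]) auto
  with \<open>i \<noteq> j\<close> show ?thesis by auto
qed

text \<open>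
  On the face shared by the two cells, both increments, divided by the common value of \<open>g i k\<close>, are
  orthogonal to the frame vectors of the other directions, which the two cells have in common. The
  orthogonal complement of those is a line.
\<close>
lemma adjacent_increments_parallel:
  assumes c: "c \<in> C" and c': "c + axis i (1 / 2) \<in> C"
  shows "\<exists>s. s \<noteq> 0 \<and> (\<forall>k. increment i k (c $ i) = s * increment i k (c $ i + 1 / 2))"
proof -
  define c' where "c' = c + axis i (1 / 2)"
  have c'C: "c' \<in> C" using c' by (simp add: c'_def)
  have i: "c' $ i = c $ i + 1 / 2" by (simp add: c'_def axis_def)
  have j: "c' $ j = c $ j" if "j \<noteq> i" for j using that by (simp add: c'_def axis_def)
  have gi: "c' $ i - 1 / 4 = c $ i + 1 / 4" using i by simp
  have "\<exists>s. \<forall>k. increment i k (c $ i) / g i k (c $ i + 1 / 4) = s * frame c' i k"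
  proof (rule orthogonal_to_others_imp_multiple[OF c'C])
    fix j assume ji: "j \<noteq> i"
    have "weight c' k * (increment i k (c $ i) / g i k (c $ i + 1 / 4)) * frame c' j k =
        increment i k (c $ i) * increment j k (c $ j) *
        (\<Prod>l\<in>UNIV-{i, j}. g l k (c $ l - 1 / 4))" for k
    proof -
      have "(\<Prod>l\<in>UNIV-{i, j}. g l k (c' $ l - 1 / 4)) = (\<Prod>l\<in>UNIV-{i, j}. g l k (c $ l - 1 / 4))"
        by (rule prod.cong) (auto simp: j)
      then show ?thesis
        unfolding weight_def prod_remove_two[OF ji[symmetric]] frame_def gi j[OF ji]
        using lower_nonzero[OF c, of j k] upper_nonzero[OF c, of i k] by simp
    qed
    then show "(\<Sum>k\<in>UNIV. weight c' k * (increment i k (c $ i) / g i k (c $ i + 1 / 4)) *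
        frame c' j k) = 0"
      using lower_corner_orthogonal[OF c ji[symmetric]] by simp
  qed
  then obtain s where s: "increment i k (c $ i) / g i k (c $ i + 1 / 4) = s * frame c' i k" for k
    by blast
  then have s': "increment i k (c $ i) = s * increment i k (c $ i + 1 / 2)" for k
    using s[of k] upper_nonzero[OF c, of i k] unfolding frame_def gi unfolding i
    by (simp only: times_divide_eq_right divide_cancel_right simp_thms)
  moreover have "s \<noteq> 0"
    using s'[of i] increment_nonzero[OF c, of i i] by (auto simp: increment_def)
  ultimately show ?thesis by blast
qed

text \<open>
  Adding up parallel increments: for each \<open>i\<close> the points \<open>(g i k m)\<^sub>k\<close> lie on one line.
\<close>
lemma on_line:
  assumes c0: "c0 \<in> C"
  shows "\<exists>\<phi>. \<forall>i. \<forall>m\<in>dual_coordinates i. \<forall>k.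
    g i k m = g i k (c0 $ i - 1 / 4) + \<phi> i m * increment i k (c0 $ i)"
proof -
  have "\<exists>\<phi>. \<forall>k. g i k m = g i k (c0 $ i - 1 / 4) + \<phi> * increment i k (c0 $ i)"
    if m: "m \<in> dual_coordinates i" for i m
  proof -
    define K where "K k = increment i k (c0 $ i)" for k
    define Q where "Q t \<longleftrightarrow> (\<exists>r s. r \<noteq> 0 \<and> (\<forall>k. increment i k t = r * K k) \<and>
      (\<forall>k. g i k (t - 1 / 4) = g i k (c0 $ i - 1 / 4) + s * K k))" for t
    have Q: "Q (c $ i)" if "c \<in> C" for c
    proof (rule coordinate_induct[where Q = Q, OF c0 _ _ that])
      show "Q (c0 $ i)" unfolding Q_def K_def by (intro exI[of _ 1] exI[of _ 0]) simp
      fix c assume c: "c \<in> C" "c + axis i (1 / 2) \<in> C"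
      from adjacent_increments_parallel[OF this] obtain s where s: "s \<noteq> 0"
        and inc: "increment i k (c $ i) = s * increment i k (c $ i + 1 / 2)" for k by blast
      have shift: "g i k (c $ i + 1 / 2 - 1 / 4) = g i k (c $ i - 1 / 4) + increment i k (c $ i)" for k
      proof -
        have "c $ i + 1 / 2 - 1 / 4 = c $ i + 1 / 4" by simp
        then have "g i k (c $ i + 1 / 2 - 1 / 4) = g i k (c $ i + 1 / 4)" by (rule arg_cong)
        then show ?thesis unfolding increment_def by linarith
      qed
      show "Q (c $ i) \<longleftrightarrow> Q (c $ i + 1 / 2)"
      proof
        assume "Q (c $ i)"
        then obtain r p where r: "r \<noteq> 0" and rK: "increment i k (c $ i) = r * K k"
          and pK: "g i k (c $ i - 1 / 4) = g i k (c0 $ i - 1 / 4) + p * K k" for k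
          unfolding Q_def by blast
        have "increment i k (c $ i + 1 / 2) = r / s * K k" for k
        proof -
          have "s * increment i k (c $ i + 1 / 2) = r * K k" unfolding inc[symmetric] rK ..
          with s have "increment i k (c $ i + 1 / 2) = r * K k / s"
            by (subst eq_divide_eq) (simp only: mult.commute simp_thms if_True)
          then show ?thesis by simp
        qed
        moreover have "g i k (c $ i + 1 / 2 - 1 / 4) = g i k (c0 $ i - 1 / 4) + (p + r) * K k" for k
          unfolding shift rK pK by (simp add: distrib_right)
        moreover have "r / s \<noteq> 0" using r s by simp
        ultimately show "Q (c $ i + 1 / 2)" unfolding Q_def by blast
      next
        assume "Q (c $ i + 1 / 2)"
        then obtain r p where r: "r \<noteq> 0" and rK: "increment i k (c $ i + 1 / 2) = r * K k"
          and pK: "g i k (c $ i + 1 / 2 - 1 / 4) = g i k (c0 $ i - 1 / 4) + p * K k" for k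
          unfolding Q_def by blast
        have inc': "increment i k (c $ i) = (s * r) * K k" for k
          unfolding inc rK by simp
        moreover have "g i k (c $ i - 1 / 4) = g i k (c0 $ i - 1 / 4) + (p - s * r) * K k" for k
          using pK[of k] inc'[of k] unfolding shift left_diff_distrib by linarith
        moreover have "s * r \<noteq> 0" using r s by simp
        ultimately show "Q (c $ i)" unfolding Q_def by blast
      qed
    qed
    from m obtain c where c: "c \<in> C" "m = c $ i - 1 / 4 \<or> m = c $ i + 1 / 4"
      unfolding dual_coordinates_def by blast
    from Q[OF c(1)] obtain r s where rs: "\<forall>k. increment i k (c $ i) = r * K k"
      "\<forall>k. g i k (c $ i - 1 / 4) = g i k (c0 $ i - 1 / 4) + s * K k"
      unfolding Q_def by blast
    have "g i k (c $ i + 1 / 4) = g i k (c0 $ i - 1 / 4) + (s + r) * K k" for k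
      using rs[rule_format, of k] unfolding increment_def by (simp add: algebra_simps)
    with rs(2) c(2) show ?thesis unfolding K_def by blast
  qed
  then have "\<forall>i. \<exists>\<phi>. \<forall>m\<in>dual_coordinates i. \<forall>k.
      g i k m = g i k (c0 $ i - 1 / 4) + \<phi> m * increment i k (c0 $ i)"
    by (intro allI bchoice) blast
  then show ?thesis by (rule choice)
qed

lemma lower_dual: "c \<in> C \<Longrightarrow> c $ i - 1 / 4 \<in> dual_coordinates i"
  and upper_dual: "c \<in> C \<Longrightarrow> c $ i + 1 / 4 \<in> dual_coordinates i"
  by (auto simp: dual_coordinates_def)

text \<open>
  The line of direction \<open>i\<close> reads \<open>K\<^sub>k (P\<^sub>i\<^sup>k + \<phi>\<^sub>i(m))\<close>, where \<open>P\<^sub>i\<close> is the inverse of the frame vector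
  in one fixed cell. A relation \<open>q\<^sub>i q\<^sub>j = \<alpha> q\<^sub>i + \<beta> q\<^sub>j\<close> between frame vectors becomes
  \<open>\<alpha> P\<^sub>j + \<beta> P\<^sub>i = 1\<close>, so any two nonconstant \<open>P\<^sub>i\<close> are affine functions of each other. For
  \<open>N > 1\<close> the hypothesis excludes that \<open>P\<^sub>i\<close> is constant in \<open>k\<close>, since \<open>g i\<close> would then move on a line
  through the origin. Any one of the \<open>P\<^sub>i\<close> can serve as the common parameter \<open>a\<close>.
\<close>
lemma linear_in_common_parameter:
  assumes moving: "\<And>i. CARD('n) > 1 \<Longrightarrow>
    \<exists>c\<in>C. \<nexists>r. \<forall>k. g i k (c $ i + 1 / 4) = r * g i k (c $ i - 1 / 4)"
  shows "\<exists>\<kappa> a u. \<forall>i k. \<forall>m\<in>dual_coordinates i. g i k m = \<kappa> i k * (a k + u i m)"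
proof -
  obtain c0 where c0: "c0 \<in> C" using centres_nonempty by blast
  obtain \<phi> where \<phi>: "m \<in> dual_coordinates i \<Longrightarrow>
      g i k m = g i k (c0 $ i - 1 / 4) + \<phi> i m * increment i k (c0 $ i)" for i m k
    using on_line[OF c0] by blast
  define P where "P i k = 1 / frame c0 i k" for i k
  define K where "K i k = increment i k (c0 $ i)" for i k
  have g: "g i k m = K i k * (P i k + \<phi> i m)" if "m \<in> dual_coordinates i" for i k m
  proof -
    have "K i k * P i k = g i k (c0 $ i - 1 / 4)"
      using increment_nonzero[OF c0, of i k] by (simp add: K_def P_def frame_def increment_def)
    with \<phi>[OF that, of k] show ?thesis by (simp add: K_def algebra_simps)
  qed
  have nonconstant: "\<nexists>p. \<forall>k. P i k = p" if N: "CARD('n) > 1" for i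
  proof
    assume "\<exists>p. \<forall>k. P i k = p"
    then obtain p where p: "\<And>k. P i k = p" by blast
    from moving[OF N, of i] obtain c where c: "c \<in> C"
      and nr: "\<nexists>r. \<forall>k. g i k (c $ i + 1 / 4) = r * g i k (c $ i - 1 / 4)" by blast
    have gl: "g i k (c $ i - 1 / 4) = K i k * (p + \<phi> i (c $ i - 1 / 4))" for k
      using g[OF lower_dual[OF c]] p by simp
    have gu: "g i k (c $ i + 1 / 4) = K i k * (p + \<phi> i (c $ i + 1 / 4))" for k
      using g[OF upper_dual[OF c]] p by simp
    have "p + \<phi> i (c $ i - 1 / 4) \<noteq> 0" using lower_nonzero[OF c, of i i] gl[of i] by auto
    then have "\<forall>k. g i k (c $ i + 1 / 4) =
        ((p + \<phi> i (c $ i + 1 / 4)) / (p + \<phi> i (c $ i - 1 / 4))) * g i k (c $ i - 1 / 4)"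
      unfolding gl gu by simp
    with nr show False by blast
  qed
  fix i0 :: 'n
  have "\<exists>A B. A \<noteq> 0 \<and> (\<forall>k. P i k = A * P i0 k + B)" for i
  proof (cases "i = i0")
    case True
    then show ?thesis by (intro exI[of _ 1] exI[of _ 0]) simp
  next
    case False
    have "card {i, i0} \<le> CARD('n)" by (rule card_mono) auto
    with False have N: "CARD('n) > 1" by simp
    obtain \<alpha> \<beta> where ab: "frame c0 i k * frame c0 i0 k = \<alpha> * frame c0 i k + \<beta> * frame c0 i0 k" for k
      using frame_products[OF c0 False] by blast
    have rel: "\<alpha> * P i0 k + \<beta> * P i k = 1" for k
    proof -
      have "\<alpha> * P i0 k + \<beta> * P i k =
          (\<alpha> * frame c0 i k + \<beta> * frame c0 i0 k) / (frame c0 i k * frame c0 i0 k)"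
        using frame_nonzero[OF c0, of i k] frame_nonzero[OF c0, of i0 k]
        by (simp add: P_def add_divide_distrib)
      also have "\<dots> = 1"
        unfolding ab[symmetric] using frame_nonzero[OF c0] by simp
      finally show ?thesis .
    qed
    have "\<beta> \<noteq> 0"
    proof
      assume "\<beta> = 0"
      then have "\<alpha> * P i0 k = 1" for k using rel[of k] by simp
      then have "P i0 k = 1 / \<alpha>" for k
        by (metis mult_zero_left nonzero_mult_div_cancel_left zero_neq_one)
      with nonconstant[OF N] show False by blast
    qed
    then have eq: "P i k = (- \<alpha> / \<beta>) * P i0 k + 1 / \<beta>" for k
    proof -
      have "\<beta> * P i k = 1 - \<alpha> * P i0 k" using rel[of k] by linarith
      then have "P i k = (1 - \<alpha> * P i0 k) / \<beta>"
        using \<open>\<beta> \<noteq> 0\<close> by (metis nonzero_mult_div_cancel_left)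
      then show ?thesis by (simp add: diff_divide_distrib)
    qed
    have "\<alpha> \<noteq> 0"
    proof
      assume "\<alpha> = 0"
      then have "\<forall>k. P i k = 1 / \<beta>" using eq by simp
      with nonconstant[OF N] show False by blast
    qed
    with \<open>\<beta> \<noteq> 0\<close> eq show ?thesis by (intro exI[of _ "- \<alpha> / \<beta>"] exI[of _ "1 / \<beta>"]) simp
  qed
  then obtain A B where A: "\<And>i. A i \<noteq> 0" and P: "\<And>i k. P i k = A i * P i0 k + B i"
    by metis
  have "g i k m = (K i k * A i) * (P i0 k + (B i + \<phi> i m) / A i)"
    if "m \<in> dual_coordinates i" for i k m
    unfolding g[OF that] P[of i k] using A[of i] by (simp add: field_simps)
  then show ?thesis
    by (intro exI[of _ "\<lambda>i k. K i k * A i"] exI[of _ "P i0"]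
        exI[of _ "\<lambda>i m. (B i + \<phi> i m) / A i"]) simp
qed

text \<open>
  Subtracting the equations at two ends of an edge in direction \<open>j \<noteq> i\<close> shows that \<open>1/(a + u\<^sub>i)\<close> is
  orthogonal to \<open>q\<^sub>j\<close>; so it is a multiple of \<open>q\<^sub>i\<close>. This holds at both values of \<open>m\<^sub>i\<close> in the
  cell, where passing to the upper value multiplies the weight by \<open>1 + q\<^sub>i\<close>. Therefore
  \<open>g\<^sub>i/(a + u\<^sub>i)\<close> is the same at both values, and by connectedness it is constant in \<open>m\<close>.
\<close>
lemma polarity_imp_linear:
  assumes pol: "\<And>c \<sigma> i. c \<in> C \<Longrightarrow> \<forall>l. \<sigma> l = 1 \<or> \<sigma> l = -1 \<Longrightarrow>
      (\<forall>k. a k + u i (c $ i + \<sigma> i / 4) \<noteq> 0) \<and>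
      (\<Sum>k\<in>UNIV. (\<Prod>l\<in>UNIV. g l k (c $ l + \<sigma> l / 4)) / (a k + u i (c $ i + \<sigma> i / 4))) = 1"
  shows "\<exists>\<kappa>. \<forall>i k. \<forall>m\<in>dual_coordinates i. g i k m = \<kappa> i k * (a k + u i m)"
proof -
  have lower: "a k + u i (c $ i - 1 / 4) \<noteq> 0" if "c \<in> C" for c i k
    using pol[OF that, of "\<lambda>_. -1" i] by simp
  have upper: "a k + u i (c $ i + 1 / 4) \<noteq> 0" if "c \<in> C" for c i k
    using pol[OF that, of "\<lambda>_. 1" i] by simp
  have ratio: "g i k (c $ i + 1 / 4) / (a k + u i (c $ i + 1 / 4)) =
      g i k (c $ i - 1 / 4) / (a k + u i (c $ i - 1 / 4))" if c: "c \<in> C" for c i k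
  proof -
    have up: "g l k (c $ l + 1 / 4) = g l k (c $ l - 1 / 4) * (1 + frame c l k)" for l k
      using lower_nonzero[OF c, of l k] by (simp add: frame_def increment_def field_simps)
    define v where "v k = 1 / (a k + u i (c $ i - 1 / 4))" for k
    define w where "w k = (1 + frame c i k) / (a k + u i (c $ i + 1 / 4))" for k
    have v1: "(\<Sum>k\<in>UNIV. weight c k * v k) = 1"
      using pol[OF c, of "\<lambda>_. -1" i] by (simp add: weight_def v_def)
    \<comment> \<open>The corners of the dual cell are indexed by the set \<open>T\<close> of directions with the upper value.\<close>
    have shift: "(\<Prod>l\<in>UNIV. g l k (c $ l + (if l \<in> T then 1 else -1) / 4)) =
        weight c k * (\<Prod>l\<in>T. 1 + frame c l k)" for T k
    proof -
      have "(\<Prod>l\<in>UNIV. g l k (c $ l + (if l \<in> T then 1 else -1) / 4)) =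
          (\<Prod>l\<in>UNIV. g l k (c $ l - 1 / 4) * (if l \<in> T then 1 + frame c l k else 1))"
        by (rule prod.cong) (auto simp: up)
      also have "\<dots> = weight c k * (\<Prod>l\<in>T. 1 + frame c l k)"
        by (simp add: prod.distrib weight_def prod.If_cases)
      finally show ?thesis .
    qed
    have polT: "(\<Sum>k\<in>UNIV. weight c k * (\<Prod>l\<in>T. 1 + frame c l k) /
        (a k + u i (c $ i + (if i \<in> T then 1 else -1) / 4))) = 1" for T
      using pol[OF c, of "\<lambda>l. if l \<in> T then 1 else -1" i] unfolding shift by simp
    have w1: "(\<Sum>k\<in>UNIV. weight c k * w k) = 1"
      using polT[of "{i}"] by (simp add: w_def)
    have "\<exists>s. \<forall>k. v k = s * frame c i k"
    proof (rule orthogonal_to_others_imp_multiple[OF c])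
      fix j assume "j \<noteq> i"
      then have "(\<Sum>k\<in>UNIV. weight c k * v k + weight c k * v k * frame c j k) = 1"
        using polT[of "{j}"] by (simp add: v_def algebra_simps add_divide_distrib)
      with v1 show "(\<Sum>k\<in>UNIV. weight c k * v k * frame c j k) = 0"
        by (simp add: sum.distrib)
    qed
    then obtain s where s: "\<And>k. v k = s * frame c i k" by blast
    have "\<exists>t. \<forall>k. w k = t * frame c i k"
    proof (rule orthogonal_to_others_imp_multiple[OF c])
      fix j assume "j \<noteq> i"
      then have "(\<Sum>k\<in>UNIV. weight c k * w k + weight c k * w k * frame c j k) = 1"
        using polT[of "{i, j}"] by (simp add: w_def algebra_simps add_divide_distrib)
      with w1 show "(\<Sum>k\<in>UNIV. weight c k * w k * frame c j k) = 0"
        by (simp add: sum.distrib)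
    qed
    then obtain t where t: "\<And>k. w k = t * frame c i k" by blast
    \<comment> \<open>Both multiples of the frame vector are normalized by the same linear equation.\<close>
    have "s * (\<Sum>k\<in>UNIV. weight c k * frame c i k) = 1"
      using v1 unfolding s by (simp add: sum_distrib_left mult_ac)
    moreover have "t * (\<Sum>k\<in>UNIV. weight c k * frame c i k) = 1"
      using w1 unfolding t by (simp add: sum_distrib_left mult_ac)
    ultimately have "s = t" by (metis mult_right_cancel mult_zero_right zero_neq_one)
    then have "v k = w k" using s t by simp
    then show ?thesis unfolding up v_def w_def
      by (metis (no_types, lifting) times_divide_eq_right mult.right_neutral)
  qed
  obtain c0 where c0: "c0 \<in> C" using centres_nonempty by blast
  define \<kappa> where "\<kappa> i k = g i k (c0 $ i - 1 / 4) / (a k + u i (c0 $ i - 1 / 4))" for i k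
  have \<kappa>: "g i k (c $ i - 1 / 4) / (a k + u i (c $ i - 1 / 4)) = \<kappa> i k" if "c \<in> C" for c i k
  proof (rule coordinate_induct[where Q = "\<lambda>t. g i k (t - 1 / 4) / (a k + u i (t - 1 / 4)) = \<kappa> i k",
        OF c0 _ _ that])
    show "g i k (c0 $ i - 1 / 4) / (a k + u i (c0 $ i - 1 / 4)) = \<kappa> i k" by (simp add: \<kappa>_def)
    fix c assume "c \<in> C" "c + axis i (1 / 2) \<in> C"
    have "c $ i + 1 / 2 - 1 / 4 = c $ i + 1 / 4" by simp
    then show "(g i k (c $ i - 1 / 4) / (a k + u i (c $ i - 1 / 4)) = \<kappa> i k) \<longleftrightarrow>
        (g i k (c $ i + 1 / 2 - 1 / 4) / (a k + u i (c $ i + 1 / 2 - 1 / 4)) = \<kappa> i k)"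
      using ratio[OF \<open>c \<in> C\<close>] by metis
  qed
  have "g i k m = \<kappa> i k * (a k + u i m)" if "m \<in> dual_coordinates i" for i k m
  proof -
    from that obtain c where c: "c \<in> C" "m = c $ i - 1 / 4 \<or> m = c $ i + 1 / 4"
      unfolding dual_coordinates_def by blast
    have "a k + u i m \<noteq> 0" using lower[OF c(1)] upper[OF c(1)] c(2) by auto
    moreover have "g i k m / (a k + u i m) = \<kappa> i k"
      using c(2) \<kappa>[OF c(1), of i k] ratio[OF c(1), of i k] by auto
    ultimately show ?thesis by (simp add: field_simps)
  qed
  then show ?thesis by blast
qed

text \<open>
  In the linear form, the frame vectors of a cell are multiples of \<open>1/(a + b\<^sub>l)\<close>. If two entries of
  \<open>a\<close> agreed, the frame could not span. By Lagrange interpolation the frame is also orthogonal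
  for the weights \<open>V\<^sub>k = \<Prod>\<^sub>l (b\<^sub>l + a\<^sub>k) / \<Prod>\<^sub>j\<^sub>\<noteq>\<^sub>k (a\<^sub>k - a\<^sub>j)\<close>. Then \<open>(V/W) q\<^sub>i\<close> is orthogonal to all
  \<open>q\<^sub>j\<close> with \<open>j \<noteq> i\<close> for the weights \<open>W\<close>, so it is a multiple of \<open>q\<^sub>i\<close>, and \<open>V\<close> is proportional to \<open>W\<close>.
\<close>
lemma linear_imp_product_formula:
  assumes lin: "\<And>i k m. m \<in> dual_coordinates i \<Longrightarrow> g i k m = \<kappa> i k * (a k + u i m)"
  shows "inj a \<and> (\<exists>\<mu>. \<mu> \<noteq> 0 \<and> (\<forall>m. (\<forall>i. m i \<in> dual_coordinates i) \<longrightarrow> (\<forall>k.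
    (\<Prod>l\<in>UNIV. g l k (m l)) = \<mu> * ((\<Prod>j\<in>UNIV. u j (m j) + a k) / (\<Prod>j\<in>UNIV-{k}. a k - a j)))))"
proof -
  obtain c where c: "c \<in> C" using centres_nonempty by blast
  define b where "b l = u l (c $ l - 1 / 4)" for l
  define \<delta> where "\<delta> l = u l (c $ l + 1 / 4) - b l" for l
  have gl: "g l k (c $ l - 1 / 4) = \<kappa> l k * (a k + b l)" for l k
    unfolding b_def by (rule lin[OF lower_dual[OF c]])
  have ab: "a k + b l \<noteq> 0" and \<kappa>0: "\<kappa> l k \<noteq> 0" for l k
    using lower_nonzero[OF c, of l k] unfolding gl by auto
  have fr: "frame c l k = \<delta> l / (a k + b l)" for l k
    unfolding frame_def increment_def gl lin[OF upper_dual[OF c]] \<delta>_def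
      right_diff_distrib[symmetric]
    using \<kappa>0[of l k] by simp
  have inj: "inj a"
  proof (rule injI, rule ccontr)
    fix k k' assume eq: "a k = a k'" and ne: "k \<noteq> k'"
    have "\<exists>s. \<forall>i. (if i = k then 1 else 0) = (\<Sum>j\<in>UNIV. s j * frame c j i)"
      by (rule frame_expansion[OF c]) auto
    then obtain s where s: "\<And>i. (if i = k then 1 else 0) = (\<Sum>j\<in>UNIV. s j * frame c j i)" by blast
    have "(\<Sum>j\<in>UNIV. s j * frame c j k) = (\<Sum>j\<in>UNIV. s j * frame c j k')"
      unfolding fr eq ..
    with s[of k] s[of k'] ne show False by auto
  qed
  define L where "L k = (\<Prod>j\<in>UNIV-{k}. a k - a j)" for k
  have L: "L k \<noteq> 0" for k using inj by (auto simp: L_def dest: injD)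
  define V where "V k = (\<Prod>l\<in>UNIV. b l + a k) / L k" for k
  fix i :: 'n
  have "\<exists>s. \<forall>k. V k / weight c k * frame c i k = s * frame c i k"
  proof (rule orthogonal_to_others_imp_multiple[OF c])
    fix j assume ji: "j \<noteq> i"
    \<comment> \<open>What remains is a product of \<open>N - 2\<close> linear factors, one too few for a nonzero Lagrange sum.\<close>
    have "weight c k * (V k / weight c k * frame c i k) * frame c j k =
        \<delta> i * \<delta> j * ((\<Prod>l\<in>UNIV-{i, j}. b l + a k) / L k)" for k
      unfolding V_def prod_remove_two[OF ji[symmetric]] fr
      using weight_nonzero[OF c, of k] ab[of k i] ab[of k j] by (simp add: add.commute)
    then have "(\<Sum>k\<in>UNIV. weight c k * (V k / weight c k * frame c i k) * frame c j k) =
        \<delta> i * \<delta> j * (\<Sum>k\<in>UNIV. (\<Prod>l\<in>UNIV-{i, j}. b l + a k) / L k)"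
      by (simp add: sum_distrib_left)
    also have "(\<Sum>k\<in>UNIV. (\<Prod>l\<in>UNIV-{i, j}. b l + a k) / L k) = 0"
    proof -
      have "card {i, j} \<le> CARD('n)" by (rule card_mono) auto
      moreover have "card (UNIV - {i, j}) = CARD('n) - card {i, j}" by (rule card_Diff_subset) auto
      ultimately have "card (UNIV - {i, j}) + 2 = CARD('n)" using ji by simp
      then show ?thesis
        unfolding L_def by (subst lagrange_sum_of_linear_factors[OF inj]) auto
    qed
    finally show "(\<Sum>k\<in>UNIV. weight c k * (V k / weight c k * frame c i k) * frame c j k) = 0"
      by simp
  qed
  then obtain s where V: "\<And>k. V k / weight c k * frame c i k = s * frame c i k" by blast
  then have s: "V k = s * weight c k" for k
  proof -
    have "V k / weight c k = s"
      using V[of k] frame_nonzero[OF c, of i k]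
      by (metis mult_right_cancel)
    with weight_nonzero[OF c, of k] show ?thesis by (metis nonzero_divide_eq_eq)
  qed
  have V0: "V k \<noteq> 0" for k using L ab by (auto simp: V_def add.commute)
  then have s0: "s \<noteq> 0" using s[of i] by auto
  define \<mu> where "\<mu> = 1 / s"
  have "weight c k = (\<Prod>l\<in>UNIV. \<kappa> l k) * (\<Prod>l\<in>UNIV. b l + a k)" for k
    unfolding weight_def gl prod.distrib by (simp add: add.commute)
  then have "(\<Prod>l\<in>UNIV. \<kappa> l k) = \<mu> / L k" for k
    using s[of k] s0 V0[of k] L[of k] unfolding V_def \<mu>_def by (simp add: field_simps)
  then have "(\<Prod>l\<in>UNIV. g l k (m l)) = \<mu> * ((\<Prod>j\<in>UNIV. u j (m j) + a k) / L k)"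
    if "\<forall>i. m i \<in> dual_coordinates i" for m k
    using that by (simp add: lin prod.distrib add.commute)
  moreover have "\<mu> \<noteq> 0" using s0 by (simp add: \<mu>_def)
  ultimately show ?thesis using inj unfolding L_def by blast
qed

end

section \<open>From factorized orthogonal nets to the dual lattice\<close>

text \<open>
  The factor contributed by direction \<open>i\<close> to the componentwise product of two net points whose midpoint has
  \<open>i\<close>-th coordinate \<open>m\<close>; both signs of the half step give the same factor.
\<close>
definition edge_product :: "('n \<Rightarrow> 'n \<Rightarrow> real \<Rightarrow> real) \<Rightarrow> 'n \<Rightarrow> 'n \<Rightarrow> real \<Rightarrow> real" where
  "edge_product f i k m = f i k (m - 1 / 4) * f i k (m + 1 / 4)"

lemma edge_product_of_neighbours:
  assumes "s = 1 \<or> s = -1"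
  shows "edge_product f i k (t + s / 4) = f i k t * f i k (t + s / 2)"
proof -
  have "t + 1 / 4 - 1 / 4 = t" "t + 1 / 4 + 1 / 4 = t + 1 / 2"
    "t + -1 / 4 - 1 / 4 = t + -1 / 2" "t + -1 / 4 + 1 / 4 = t" by simp_all
  with assms show ?thesis unfolding edge_product_def by (metis mult.commute)
qed

lemma edge_product_upper: "edge_product f i k (t + 1 / 4) = f i k t * f i k (t + 1 / 2)"
  using edge_product_of_neighbours[of 1] by simp

lemma edge_product_lower: "edge_product f i k (t - 1 / 4) = f i k t * f i k (t - 1 / 2)"
  using edge_product_of_neighbours[of "-1"] by simp

locale factorized_orthogonal_net =
  fixes U C :: "(real ^ 'n) set" and x :: "real ^ 'n \<Rightarrow> real ^ 'n"
    and f :: "'n \<Rightarrow> 'n \<Rightarrow> real \<Rightarrow> real"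
  assumes C_nonempty: "C \<noteq> {}" and C_half: "C \<subseteq> half_lattice"
    and C_connected: "C \<times> C \<subseteq> (lattice_neighbours C)\<^sup>*"
    and U_cells: "U = (\<Union>c\<in>C. lattice_cell c)"
    and x_product: "n \<in> U \<Longrightarrow> x n $ k = (\<Prod>i\<in>UNIV. f i k (n $ i))"
    and f_nonzero: "n \<in> U \<Longrightarrow> f i k (n $ i) \<noteq> 0"
    and f_moves: "n \<in> U \<Longrightarrow> f i k (n $ i) - f i k (n $ i - 1) \<noteq> 0"
    and coordinate_system: "discrete_coordinate_system U x"
    and orthogonal_net: "orthogonal_net U x"
begin

lemma cell_point:
  assumes c: "c \<in> C" and s: "\<And>i. s i \<in> {-1 / 2, 0, 1 / 2}"
  shows "(\<chi> i. c $ i + s i) \<in> U"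
proof -
  have "2 * (c $ i + s i) \<in> \<int>" for i
  proof -
    have "2 * (c $ i) \<in> \<int>" using c C_half by (auto simp: half_lattice_def)
    moreover have "2 * s i \<in> {- 1, 0, 1}" using s[of i] by auto
    then have "2 * s i \<in> \<int>" by auto
    ultimately show ?thesis unfolding distrib_left by (rule Ints_add)
  qed
  moreover have "\<bar>s i\<bar> \<le> 1 / 2" for i using s[of i] by auto
  ultimately show ?thesis using c
    unfolding U_cells by (auto simp: lattice_cell_def half_lattice_def intro!: bexI[of _ c])
qed

lemma f_nonzero_in_cell: "c \<in> C \<Longrightarrow> s \<in> {-1 / 2, 0, 1 / 2} \<Longrightarrow> f i k (c $ i + s) \<noteq> 0"
  using f_nonzero[OF cell_point[of c "\<lambda>_. s"]] by simp

lemma f_moves_in_cell: "c \<in> C \<Longrightarrow> f i k (c $ i + 1 / 2) - f i k (c $ i - 1 / 2) \<noteq> 0"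
  using f_moves[OF cell_point[of c "\<lambda>_. 1 / 2"], of i k] by simp

text \<open>
  The edge of direction \<open>i\<close> through the centre \<open>c\<close> and the corners of the dual hyperplane have
  complementary coordinates: multiplying the \<open>k\<close>-th components pairs \<open>f i k (c $ i)\<close> with
  \<open>f i k (c $ i \<plusminus> 1/2)\<close> and, for \<open>l \<noteq> i\<close>, \<open>f l k (c $ l)\<close> with \<open>f l k (c $ l \<plusminus> 1/2)\<close>.
\<close>
lemma cell_edge_orthogonal:
  assumes c: "c \<in> C"
  shows "\<exists>b. \<forall>\<sigma>. (\<forall>l. \<sigma> l = 1 \<or> \<sigma> l = -1) \<longrightarrow>
    (\<Sum>k\<in>UNIV. (edge_product f i k (c $ i + 1 / 4) - edge_product f i k (c $ i - 1 / 4)) *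
      (\<Prod>l\<in>UNIV-{i}. edge_product f l k (c $ l + \<sigma> l / 4))) = b"
proof -
  define n where "n = c - axis i (1 / 2)"
  have n: "n = (\<chi> l. c $ l + (if l = i then -1 / 2 else 0))"
    by (simp add: n_def vec_eq_iff axis_def)
  have n1: "n + axis i 1 = (\<chi> l. c $ l + (if l = i then 1 / 2 else 0))"
    by (simp add: n_def vec_eq_iff axis_def)
  have nU: "n \<in> U" unfolding n by (rule cell_point[OF c]) auto
  have n1U: "n + axis i 1 \<in> U" unfolding n1 by (rule cell_point[OF c]) auto
  have corner: "n + (1 / 2) *\<^sub>R \<sigma> = (\<chi> l. c $ l + (if l = i then 0 else \<sigma> $ l / 2))"
    if "\<sigma> $ i = 1" for \<sigma> using that by (simp add: n_def vec_eq_iff axis_def)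
  have cornerU: "n + (1 / 2) *\<^sub>R \<sigma> \<in> U" if "\<sigma> \<in> sign_vectors" "\<sigma> $ i = 1" for \<sigma>
    unfolding corner[OF that(2)]
  proof (rule cell_point[OF c])
    fix l
    have "\<sigma> $ l = 1 \<or> \<sigma> $ l = -1" using that by (simp add: sign_vectors_def)
    then show "(if l = i then 0 else \<sigma> $ l / 2) \<in> {-1 / 2, 0, 1 / 2}" by auto
  qed
  have "\<exists>b. \<forall>\<sigma>\<in>sign_vectors. \<sigma> $ i = 1 \<longrightarrow>
      x (n + (1 / 2) *\<^sub>R \<sigma>) \<in> {y. (x (n + axis i 1) - x n) \<bullet> y = b}"
    by (rule orthogonal_net[unfolded orthogonal_net_def, rule_format]) (use nU n1U cornerU in simp)
  then obtain b where b: "\<And>\<sigma>. \<sigma> \<in> sign_vectors \<Longrightarrow> \<sigma> $ i = 1 \<Longrightarrow>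
      (x (n + axis i 1) - x n) \<bullet> x (n + (1 / 2) *\<^sub>R \<sigma>) = b"
    by (elim exE) simp
  have "(\<Sum>k\<in>UNIV. (edge_product f i k (c $ i + 1 / 4) - edge_product f i k (c $ i - 1 / 4)) *
      (\<Prod>l\<in>UNIV-{i}. edge_product f l k (c $ l + \<sigma> l / 4))) = b"
    if \<sigma>: "\<forall>l. \<sigma> l = 1 \<or> \<sigma> l = -1" for \<sigma> :: "'n \<Rightarrow> real"
  proof -
    define \<tau> :: "real ^ 'n" where "\<tau> = (\<chi> l. if l = i then 1 else \<sigma> l)"
    have \<tau>: "\<tau> \<in> sign_vectors" "\<tau> $ i = 1" using \<sigma> by (auto simp: \<tau>_def sign_vectors_def)
    have "(edge_product f i k (c $ i + 1 / 4) - edge_product f i k (c $ i - 1 / 4)) *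
        (\<Prod>l\<in>UNIV-{i}. edge_product f l k (c $ l + \<sigma> l / 4)) =
        (x (n + axis i 1) - x n) $ k * x (n + (1 / 2) *\<^sub>R \<tau>) $ k" for k
    proof -
      have x1: "x (n + axis i 1) $ k = f i k (c $ i + 1 / 2) * (\<Prod>l\<in>UNIV-{i}. f l k (c $ l))"
        unfolding x_product[OF n1U] unfolding n1 by (subst prod.remove[of UNIV i]) auto
      have x0: "x n $ k = f i k (c $ i - 1 / 2) * (\<Prod>l\<in>UNIV-{i}. f l k (c $ l))"
        unfolding x_product[OF nU] unfolding n by (subst prod.remove[of UNIV i]) auto
      have xc: "x (n + (1 / 2) *\<^sub>R \<tau>) $ k =
          f i k (c $ i) * (\<Prod>l\<in>UNIV-{i}. f l k (c $ l + \<sigma> l / 2))"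
        unfolding x_product[OF cornerU[OF \<tau>]] unfolding corner[OF \<tau>(2)]
        by (subst prod.remove[of UNIV i]) (auto simp: \<tau>_def)
      have "(\<Prod>l\<in>UNIV-{i}. edge_product f l k (c $ l + \<sigma> l / 4)) =
          (\<Prod>l\<in>UNIV-{i}. f l k (c $ l)) * (\<Prod>l\<in>UNIV-{i}. f l k (c $ l + \<sigma> l / 2))"
        using \<sigma> by (simp add: edge_product_of_neighbours prod.distrib)
      then show ?thesis
        unfolding vector_minus_component x1 x0 xc edge_product_upper edge_product_lower
        by (simp only: algebra_simps)
    qed
    then show ?thesis using b[OF \<tau>] by (simp add: inner_vec_def)
  qed
  then show ?thesis by blast
qed

lemma cell_faces_orthogonal:
  assumes c: "c \<in> C" and ij: "i \<noteq> j" and \<sigma>: "\<forall>l. \<sigma> l = 1 \<or> \<sigma> l = -1"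
  shows "(\<Sum>k\<in>UNIV. (edge_product f i k (c $ i + 1 / 4) - edge_product f i k (c $ i - 1 / 4)) *
    (edge_product f j k (c $ j + 1 / 4) - edge_product f j k (c $ j - 1 / 4)) *
    (\<Prod>l\<in>UNIV-{i, j}. edge_product f l k (c $ l + \<sigma> l / 4))) = 0"
proof -
  define D where "D k = edge_product f i k (c $ i + 1 / 4) - edge_product f i k (c $ i - 1 / 4)" for k
  define R where "R k = (\<Prod>l\<in>UNIV-{i, j}. edge_product f l k (c $ l + \<sigma> l / 4))" for k
  obtain b where b: "\<And>\<sigma>. (\<forall>l. \<sigma> l = 1 \<or> \<sigma> l = -1) \<Longrightarrow>
      (\<Sum>k\<in>UNIV. D k * (\<Prod>l\<in>UNIV-{i}. edge_product f l k (c $ l + \<sigma> l / 4))) = b"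
    using cell_edge_orthogonal[OF c, of i] unfolding D_def by blast
  have "(\<Prod>l\<in>UNIV-{i}. edge_product f l k (c $ l + (\<sigma>(j := s)) l / 4)) =
      edge_product f j k (c $ j + s / 4) * R k" for s k
    using ij unfolding R_def by (subst prod.remove[of _ j]) (auto simp: Diff_insert2[symmetric])
  then have split: "(\<Sum>k\<in>UNIV. D k * (edge_product f j k (c $ j + s / 4) * R k)) = b"
    if "s = 1 \<or> s = -1" for s
    using b[of "\<sigma>(j := s)"] \<sigma> that by simp
  have "(\<Sum>k\<in>UNIV. D k * (edge_product f j k (c $ j + 1 / 4) -
      edge_product f j k (c $ j - 1 / 4)) * R k) =
      (\<Sum>k\<in>UNIV. D k * (edge_product f j k (c $ j + 1 / 4) * R k)) -
      (\<Sum>k\<in>UNIV. D k * (edge_product f j k (c $ j - 1 / 4) * R k))"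
    unfolding sum_subtractf[symmetric]
    by (rule sum.cong) (simp_all add: left_diff_distrib right_diff_distrib mult.assoc)
  also have "\<dots> = 0" using split[of 1] split[of "-1"] by simp
  finally have "(\<Sum>k\<in>UNIV. D k * (edge_product f j k (c $ j + 1 / 4) -
      edge_product f j k (c $ j - 1 / 4)) * R k) = 0" .
  then show ?thesis by (simp add: D_def R_def)
qed

text \<open>
  The relative increments of \<open>edge_product\<close> and of \<open>f\<close> across a cell agree, because \<open>f j k (c $ j)\<close>
  cancels. Multiplied by the corner \<open>x n\<close> they are the tangent vectors at \<open>n\<close>.
\<close>
lemma tangents_independent:
  assumes c: "c \<in> C"
    and s: "\<And>k. (\<Sum>j\<in>UNIV. s j *
      ((edge_product f j k (c $ j + 1 / 4) - edge_product f j k (c $ j - 1 / 4)) /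
        edge_product f j k (c $ j - 1 / 4))) = 0"
  shows "\<forall>j. s j = 0"
proof -
  define n where "n = (\<chi> l. c $ l + - 1 / 2)"
  define t where "t j = x (n + axis j 1) - x n" for j
  have nU: "n \<in> U" unfolding n_def by (rule cell_point[OF c]) auto
  have n1: "n + axis j 1 = (\<chi> l. c $ l + (if l = j then 1 / 2 else - 1 / 2))" for j
    by (simp add: n_def vec_eq_iff axis_def)
  have n1U: "n + axis j 1 \<in> U" for j unfolding n1 by (rule cell_point[OF c]) auto
  have "inj t \<and> independent (range t)"
    by (rule coordinate_system[unfolded discrete_coordinate_system_def, THEN conjunct2, rule_format,
          OF nU]) (simp add: n1U t_def)
  then have "inj t" and ind: "independent (range t)" by simp_all
  have t: "t j $ k = x n $ k *
      ((edge_product f j k (c $ j + 1 / 4) - edge_product f j k (c $ j - 1 / 4)) /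
        edge_product f j k (c $ j - 1 / 4))" for j k
  proof -
    define R where "R = (\<Prod>l\<in>UNIV-{j}. f l k (c $ l - 1 / 2))"
    have "x (n + axis j 1) $ k = f j k (c $ j + 1 / 2) * R"
      unfolding x_product[OF n1U] unfolding n1 R_def by (subst prod.remove[of UNIV j]) auto
    moreover have x0: "x n $ k = f j k (c $ j - 1 / 2) * R"
      unfolding x_product[OF nU] unfolding n_def R_def by (subst prod.remove[of UNIV j]) auto
    moreover have "f j k (c $ j) \<noteq> 0" "f j k (c $ j - 1 / 2) \<noteq> 0"
      using f_nonzero_in_cell[OF c, of 0 j k] f_nonzero_in_cell[OF c, of "- 1 / 2" j k] by simp_all
    ultimately show ?thesis
      unfolding t_def vector_minus_component edge_product_upper edge_product_lower
        right_diff_distrib[symmetric]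
      by (simp add: left_diff_distrib[symmetric])
  qed
  have "(\<Sum>j\<in>UNIV. s j *\<^sub>R t j) $ k = 0" for k
  proof -
    have "(\<Sum>j\<in>UNIV. s j *\<^sub>R t j) $ k = x n $ k * (\<Sum>j\<in>UNIV. s j *
      ((edge_product f j k (c $ j + 1 / 4) - edge_product f j k (c $ j - 1 / 4)) /
        edge_product f j k (c $ j - 1 / 4)))"
      by (simp only: sum_component vector_scaleR_component real_scaleR_def t sum_distrib_left
          mult.left_commute)
    then show ?thesis unfolding s by simp
  qed
  then have "(\<Sum>j\<in>UNIV. s j *\<^sub>R t j) = 0" by (simp add: vec_eq_iff)
  then have "(\<Sum>v\<in>range t. s (inv t v) *\<^sub>R v) = 0"
    using \<open>inj t\<close> by (simp add: sum.reindex)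
  then have "s (inv t (t j)) = 0" for j
    using independentD[OF ind, of "range t" "\<lambda>v. s (inv t v)" "t j"] by simp
  then show ?thesis using \<open>inj t\<close> by simp
qed

sublocale dual_orthogonal_system C "edge_product f"
proof
  show "C \<noteq> {}" "C \<subseteq> half_lattice" "C \<times> C \<subseteq> (lattice_neighbours C)\<^sup>*"
    by (fact C_nonempty C_half C_connected)+
  fix c i k assume c: "c \<in> C"
  have nz: "f i k (c $ i) \<noteq> 0" "f i k (c $ i - 1 / 2) \<noteq> 0" "f i k (c $ i + 1 / 2) \<noteq> 0"
    using f_nonzero_in_cell[OF c, of 0 i k] f_nonzero_in_cell[OF c, of "- 1 / 2" i k]
      f_nonzero_in_cell[OF c, of "1 / 2" i k] by simp_all
  show "edge_product f i k (c $ i - 1 / 4) \<noteq> 0" "edge_product f i k (c $ i + 1 / 4) \<noteq> 0"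
    unfolding edge_product_lower edge_product_upper using nz by simp_all
  show "edge_product f i k (c $ i + 1 / 4) - edge_product f i k (c $ i - 1 / 4) \<noteq> 0"
    unfolding edge_product_lower edge_product_upper right_diff_distrib[symmetric]
    using nz f_moves_in_cell[OF c, of i k] by simp
qed (fact cell_faces_orthogonal tangents_independent)+

lemma cell_pair:
  assumes c: "c \<in> C" and \<sigma>: "\<sigma> \<in> sign_vectors"
  shows "c \<in> U" "c + (1 / 2) *\<^sub>R \<sigma> \<in> U"
proof -
  have "(\<chi> i. c $ i + 0) \<in> U" by (rule cell_point[OF c]) simp
  then show "c \<in> U" by simp
  have "(\<chi> i. c $ i + \<sigma> $ i / 2) \<in> U"
  proof (rule cell_point[OF c])
    fix i
    have "\<sigma> $ i = 1 \<or> \<sigma> $ i = -1" using \<sigma> by (simp add: sign_vectors_def)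
    then show "\<sigma> $ i / 2 \<in> {-1 / 2, 0, 1 / 2}" by auto
  qed
  moreover have "(\<chi> i. c $ i + \<sigma> $ i / 2) = c + (1 / 2) *\<^sub>R \<sigma>" by (simp add: vec_eq_iff)
  ultimately show "c + (1 / 2) *\<^sub>R \<sigma> \<in> U" by simp
qed

lemma near_centre:
  assumes "n \<in> U"
  obtains c where "c \<in> C" "\<And>i. \<bar>n $ i - c $ i\<bar> \<le> 1 / 2"
  using assms unfolding U_cells lattice_cell_def by blast

lemma half_integer: "n \<in> U \<Longrightarrow> 2 * n $ i \<in> \<int>"
  unfolding U_cells lattice_cell_def half_lattice_def by blast

lemma pair_product:
  assumes n: "n \<in> U" and \<sigma>: "\<sigma> \<in> sign_vectors" and n': "n + (1 / 2) *\<^sub>R \<sigma> \<in> U"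
  shows "x n $ k * x (n + (1 / 2) *\<^sub>R \<sigma>) $ k =
    (\<Prod>l\<in>UNIV. edge_product f l k (n $ l + \<sigma> $ l / 4))"
proof -
  have "edge_product f l k (n $ l + \<sigma> $ l / 4) = f l k (n $ l) * f l k (n $ l + \<sigma> $ l / 2)" for l
    using \<sigma> by (intro edge_product_of_neighbours) (simp add: sign_vectors_def)
  then show ?thesis by (simp add: x_product[OF n] x_product[OF n'] prod.distrib)
qed

text \<open>
  Two net points that differ by half steps need not share a cell of \<open>U\<close>, but connectedness
  ensures that each coordinate of their midpoint occurs in some dual cell.
\<close>
lemma dual_coordinate_between_neighbours:
  assumes l: "n \<in> U" and u: "n' \<in> U" and step: "n' $ i = n $ i + 1 / 2"
  shows "n $ i + 1 / 4 \<in> dual_coordinates i"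
proof -
  obtain c where c: "c \<in> C" "\<bar>n $ i - c $ i\<bar> \<le> 1 / 2" using near_centre[OF l] by blast
  obtain d where d: "d \<in> C" "\<bar>n' $ i - d $ i\<bar> \<le> 1 / 2" using near_centre[OF u] by blast
  have ni: "2 * n $ i \<in> \<int>" using half_integer[OF l] .
  have ci: "2 * c $ i \<in> \<int>" using c(1) C_half by (auto simp: half_lattice_def)
  obtain p q :: int where pq: "2 * n $ i = real_of_int p" "2 * c $ i = real_of_int q"
    using ni ci by (auto elim!: Ints_cases)
  have "real_of_int (p - 1) \<le> real_of_int q" "real_of_int q \<le> real_of_int (p + 1)"
    using c(2)[unfolded abs_le_iff] pq unfolding of_int_diff of_int_add of_int_1 by linarith+
  then consider "q = p" | "q = p + 1" | "q = p - 1" unfolding of_int_le_iff by linarith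
  then show ?thesis
  proof cases
    case 1
    then have "n $ i + 1 / 4 = c $ i + 1 / 4" using pq by simp
    then show ?thesis using upper_dual[OF c(1)] by simp
  next
    case 2
    then have "n $ i + 1 / 4 = c $ i - 1 / 4" using pq by simp
    then show ?thesis using lower_dual[OF c(1), of i] by (simp only:)
  next
    case 3
    \<comment> \<open>Here the cell of \<open>n\<close> ends at \<open>n $ i\<close>; a centre on the way to \<open>d\<close> is at \<open>n $ i\<close> itself.\<close>
    then have "c $ i \<le> n $ i" using pq by simp
    moreover have "n $ i \<le> d $ i" using d(2) step by linarith
    ultimately obtain e where e: "e \<in> C" "e $ i = n $ i"
      using coordinate_between[OF c(1) d(1) ni] by blast
    then show ?thesis using upper_dual[OF e(1), of i] by simp
  qed
qed

lemma pair_dual_coordinate: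
  assumes n: "n \<in> U" and \<sigma>: "\<sigma> \<in> sign_vectors" and n': "n + (1 / 2) *\<^sub>R \<sigma> \<in> U"
  shows "n $ i + \<sigma> $ i / 4 \<in> dual_coordinates i"
proof -
  have "\<sigma> $ i = 1 \<or> \<sigma> $ i = -1" using \<sigma> by (simp add: sign_vectors_def)
  then show ?thesis
  proof
    assume "\<sigma> $ i = 1"
    then show ?thesis using dual_coordinate_between_neighbours[OF n n', of i] by simp
  next
    assume s: "\<sigma> $ i = -1"
    have "(n + (1 / 2) *\<^sub>R \<sigma>) $ i + 1 / 4 \<in> dual_coordinates i"
      by (rule dual_coordinate_between_neighbours[OF n' n]) (simp add: s)
    moreover have "(n + (1 / 2) *\<^sub>R \<sigma>) $ i + 1 / 4 = n $ i + \<sigma> $ i / 4" by (simp add: s)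
    ultimately show ?thesis by (simp only:)
  qed
qed

lemma non_conical_edge_products:
  assumes "non_conical U x" "CARD('n) > 1"
  shows "\<exists>c\<in>C. \<nexists>r. \<forall>k. edge_product f i k (c $ i + 1 / 4) = r * edge_product f i k (c $ i - 1 / 4)"
proof -
  obtain n where n: "n \<in> U" "n + axis i 1 \<in> U" and nspan: "x (n + axis i 1) \<notin> span {x n}"
    using assms unfolding non_conical_def by blast
  obtain c where c: "c \<in> C" "\<bar>n $ i - c $ i\<bar> \<le> 1 / 2" using near_centre[OF n(1)] by blast
  obtain d where d: "d \<in> C" "\<bar>(n + axis i 1) $ i - d $ i\<bar> \<le> 1 / 2" using near_centre[OF n(2)] by blast
  have "2 * (n $ i + 1 / 2) \<in> \<int>" using half_integer[OF n(1), of i] by (simp add: distrib_left)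
  moreover have "c $ i \<le> n $ i + 1 / 2" using c(2) by linarith
  moreover have "n $ i + 1 / 2 \<le> d $ i"
    using d(2)[unfolded abs_le_iff] by (simp add: axis_def)
  ultimately obtain e where e: "e \<in> C" "e $ i = n $ i + 1 / 2"
    using coordinate_between[OF c(1) d(1)] by blast
  have "\<nexists>r. \<forall>k. edge_product f i k (e $ i + 1 / 4) = r * edge_product f i k (e $ i - 1 / 4)"
  proof
    assume "\<exists>r. \<forall>k. edge_product f i k (e $ i + 1 / 4) = r * edge_product f i k (e $ i - 1 / 4)"
    then obtain r where r: "\<And>k. f i k (e $ i) * f i k (e $ i + 1 / 2) =
        r * (f i k (e $ i) * f i k (e $ i - 1 / 2))"
      unfolding edge_product_lower edge_product_upper by blast
    have ends: "e $ i + 1 / 2 = n $ i + 1" "e $ i - 1 / 2 = n $ i" using e(2) by simp_all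
    have fr: "f i k (n $ i + 1) = r * f i k (n $ i)" for k
      using r[of k] f_nonzero_in_cell[OF e(1), of 0 i k] unfolding ends by simp
    have "x (n + axis i 1) $ k = r * x n $ k" for k
    proof -
      have "x (n + axis i 1) $ k = f i k (n $ i + 1) * (\<Prod>l\<in>UNIV-{i}. f l k (n $ l))"
        unfolding x_product[OF n(2)] by (subst prod.remove[of UNIV i]) (auto simp: axis_def)
      also have "\<dots> = r * x n $ k"
        unfolding fr x_product[OF n(1)] prod.remove[OF finite UNIV_I, of _ i] by simp
      finally show ?thesis .
    qed
    then have "x (n + axis i 1) = r *\<^sub>R x n" by (simp add: vec_eq_iff)
    with nspan show False by (simp add: span_base span_scale)
  qed
  with e(1) show ?thesis by blast
qed

section \<open>Existence and equivalence of the equations\<close>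

text \<open>
  The factor \<open>\<mu>\<close> is absorbed by scaling \<open>a\<close> and \<open>u\<close>: the numerator has \<open>N\<close> factors and the
  denominator \<open>N - 1\<close>.
\<close>
lemma product_equations_exist:
  assumes "non_conical U x"
  shows "\<exists>a u. product_equations U x a u"
proof -
  obtain \<kappa> a u where lin: "\<And>i k m. m \<in> dual_coordinates i \<Longrightarrow>
      edge_product f i k m = \<kappa> i k * (a k + u i m)"
    using linear_in_common_parameter[OF non_conical_edge_products[OF assms]] by blast
  obtain \<mu> where "inj a" and \<mu>: "\<mu> \<noteq> 0" and prod: "\<And>m k. (\<And>i. m i \<in> dual_coordinates i) \<Longrightarrow>
      (\<Prod>l\<in>UNIV. edge_product f l k (m l)) =
        \<mu> * ((\<Prod>j\<in>UNIV. u j (m j) + a k) / (\<Prod>j\<in>UNIV-{k}. a k - a j))"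
    using linear_imp_product_formula[OF lin] by blast
  have "product_equations U x (\<lambda>k. \<mu> * a k) (\<lambda>i m. \<mu> * u i m)"
    unfolding product_equations_def
  proof (intro ballI impI allI conjI)
    fix j k :: 'n assume "j \<noteq> k"
    with \<open>inj a\<close> \<mu> show "\<mu> * a k - \<mu> * a j \<noteq> 0" by (auto dest: injD)
  next
    fix n \<sigma> k assume n: "n \<in> U" "\<sigma> \<in> sign_vectors" "n + (1 / 2) *\<^sub>R \<sigma> \<in> U"
    define w where "w j = u j (n $ j + \<sigma> $ j / 4)" for j
    have "CARD('n) = Suc (CARD('n) - 1)" by simp
    then have pw: "\<mu> ^ CARD('n) = \<mu> * \<mu> ^ (CARD('n) - 1)" by (metis power_Suc)
    have "x n $ k * x (n + (1 / 2) *\<^sub>R \<sigma>) $ k =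
        \<mu> * ((\<Prod>j\<in>UNIV. w j + a k) / (\<Prod>j\<in>UNIV-{k}. a k - a j))"
      unfolding pair_product[OF n] w_def using pair_dual_coordinate[OF n] by (rule prod)
    also have "\<dots> = (\<Prod>j\<in>UNIV. \<mu> * (w j + a k)) / (\<Prod>j\<in>UNIV-{k}. \<mu> * (a k - a j))"
      using \<mu> by (simp add: prod.distrib card_Diff_singleton pw)
    finally show "x n $ k * x (n + (1 / 2) *\<^sub>R \<sigma>) $ k =
        (\<Prod>j\<in>UNIV. \<mu> * u j (n $ j + \<sigma> $ j / 4) + \<mu> * a k) /
        (\<Prod>j\<in>UNIV-{k}. \<mu> * a k - \<mu> * a j)"
      by (simp only: w_def distrib_left right_diff_distrib)
  qed
  then show ?thesis by blast
qed

text \<open>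
  Comparing a single polarity equation with the Lagrange identity fixes \<open>\<mu> = 1\<close>.
\<close>
lemma polarity_imp_product:
  assumes pol: "polarity_equations U x a u"
  shows "product_equations U x a u"
proof -
  have dual_pol: "(\<forall>k. a k + u i (c $ i + \<sigma> i / 4) \<noteq> 0) \<and>
      (\<Sum>k\<in>UNIV. (\<Prod>l\<in>UNIV. edge_product f l k (c $ l + \<sigma> l / 4)) /
        (a k + u i (c $ i + \<sigma> i / 4))) = 1"
    if c: "c \<in> C" and \<sigma>: "\<forall>l. \<sigma> l = 1 \<or> \<sigma> l = -1" for c \<sigma> i
  proof -
    have s: "(\<chi> l. \<sigma> l) \<in> sign_vectors" using \<sigma> by (simp add: sign_vectors_def)
    note p = cell_pair[OF c s]
    show ?thesis
      using pol p s pair_product[OF p(1) s p(2)] unfolding polarity_equations_def by force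
  qed
  obtain \<kappa> where lin: "\<And>i k m. m \<in> dual_coordinates i \<Longrightarrow>
      edge_product f i k m = \<kappa> i k * (a k + u i m)"
    using polarity_imp_linear[OF dual_pol] by blast
  obtain \<mu> where "inj a" and \<mu>: "\<mu> \<noteq> 0" and prod: "\<And>m k. (\<And>i. m i \<in> dual_coordinates i) \<Longrightarrow>
      (\<Prod>l\<in>UNIV. edge_product f l k (m l)) =
        \<mu> * ((\<Prod>j\<in>UNIV. u j (m j) + a k) / (\<Prod>j\<in>UNIV-{k}. a k - a j))"
    using linear_imp_product_formula[OF lin] by blast
  have "\<mu> = 1"
  proof -
    obtain c where c: "c \<in> C" using C_nonempty by blast
    fix i :: 'n
    define w where "w j = u j (c $ j + 1 / 4)" for j
    have w: "\<And>k. a k + w i \<noteq> 0"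
      and sum1: "(\<Sum>k\<in>UNIV. (\<Prod>l\<in>UNIV. edge_product f l k (c $ l + 1 / 4)) / (a k + w i)) = 1"
      using dual_pol[OF c, of "\<lambda>_. 1" i] by (simp_all add: w_def)
    have "(\<Prod>l\<in>UNIV. edge_product f l k (c $ l + 1 / 4)) =
        \<mu> * ((\<Prod>j\<in>UNIV. w j + a k) / (\<Prod>j\<in>UNIV-{k}. a k - a j))" for k
      unfolding w_def by (rule prod) (rule upper_dual[OF c])
    then have "\<mu> * (\<Sum>k\<in>UNIV. (\<Prod>j\<in>UNIV. w j + a k) / (\<Prod>j\<in>UNIV-{k}. a k - a j) / (a k + w i)) = 1"
      using sum1 by (simp add: sum_distrib_left)
    then show ?thesis
      unfolding polarity_of_product_formula[of a w i, OF \<open>inj a\<close> w] by simp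
  qed
  show ?thesis
    unfolding product_equations_def
  proof (intro ballI impI allI conjI)
    fix j k :: 'n assume "j \<noteq> k"
    with \<open>inj a\<close> show "a k - a j \<noteq> 0" by (auto dest: injD)
  next
    fix n \<sigma> k assume n: "n \<in> U" "\<sigma> \<in> sign_vectors" "n + (1 / 2) *\<^sub>R \<sigma> \<in> U"
    show "x n $ k * x (n + (1 / 2) *\<^sub>R \<sigma>) $ k =
        (\<Prod>j\<in>UNIV. u j (n $ j + \<sigma> $ j / 4) + a k) / (\<Prod>j\<in>UNIV-{k}. a k - a j)"
      unfolding pair_product[OF n] using prod[OF pair_dual_coordinate[OF n], of k] \<open>\<mu> = 1\<close> by simp
  qed
qed

lemma x_nonzero: "n \<in> U \<Longrightarrow> x n $ k \<noteq> 0"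
  by (simp add: x_product f_nonzero)

lemma polarity_iff_product: "polarity_equations U x a u \<longleftrightarrow> product_equations U x a u"
  using polarity_imp_product product_imp_polarity[of U x a u] x_nonzero by blast

end

theorem theorem5p2:
  fixes U :: "(real ^ 'n) set" and x :: "real ^ 'n \<Rightarrow> real ^ 'n"
  assumes "lattice_domain U"
    and "discrete_confocal_coordinate_system U x"
    and "non_conical U x"
  shows "(\<exists>(a :: 'n \<Rightarrow> real) (u :: 'n \<Rightarrow> real \<Rightarrow> real). polarity_equations U x a u) \<and>
    (\<forall>(a :: 'n \<Rightarrow> real) (u :: 'n \<Rightarrow> real \<Rightarrow> real).
       polarity_equations U x a u \<longleftrightarrow> product_equations U x a u)"
proof -
  obtain C where C: "C \<noteq> {}" "C \<subseteq> half_lattice" "C \<times> C \<subseteq> (lattice_neighbours C)\<^sup>*"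
      "U = (\<Union>c\<in>C. lattice_cell c)"
    using assms(1) unfolding lattice_domain_def by blast
  obtain f :: "'n \<Rightarrow> 'n \<Rightarrow> real \<Rightarrow> real" where f: "\<forall>n\<in>U. \<forall>k.
        x n $ k = (\<Prod>i\<in>UNIV. f i k (n $ i)) \<and>
        (\<forall>i. f i k (n $ i) \<noteq> 0 \<and> f i k (n $ i) - f i k (n $ i - 1) \<noteq> 0)"
    using assms(2) unfolding discrete_confocal_coordinate_system_def factorizes_def by blast
  interpret factorized_orthogonal_net U C x f
    using C f assms(2) unfolding discrete_confocal_coordinate_system_def
    by unfold_locales blast+
  show ?thesis using product_equations_exist[OF assms(3)] polarity_iff_product by blast
qed

end
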